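(* Consider a multi-class $M/G/1/1$ queue with classes $\{1,\dots,N\}$, where class-$n$ update packets arrive according to a Poisson process of rate $\lambda_n>0$ and have i.i.d. service times with mean $x_n$, and where packets arriving while the server is busy are discarded. Then for every class $n$ the peak age-of-information is $$A^{mg11}_{p,n}=x_n+\frac{1}{\lambda_n}+\frac{\sum_{k=1}^N\lambda_kx_k}{\lambda_n}.$$
   Context: The system is a single server shared by $N$ entities (classes) $1,\dots,N$. Class-$n$ packets are status-update packets of entity $n$; an arrival of a class-$n$ packet is the generation of that packet, and its service completion is its reception at the destination. The class arrival processes are independent Poisson processes; service times are independent across packets and independent of the arrivals. In the $M/G/1/1$ system there is no waiting room: a packet that arrives when the server is idle begins service immediately, and a packet (of any class) that arrives while the server is busy is discarded and never received. The status age $\Delta_n(t)$ of entity $n$ at time $t$ is the time elapsed since the generation of its latest received update packet, i.e. $t$ minus the generation time of that packet. It grows at unit rate and drops at each instant at which a class-$n$ packet is received. Let $A_{nk}$ be the $k$-th peak value of $\Delta_n$, i.e. its value just before its $k$-th drop. The peak age-of-information (PAoI) of entity $n$ is $$A_{p,n}\triangleq\lim_{K\to\infty}\frac1K\sum_{k=1}^KA_{nk}.$$ The superscript $mg11$ indicates the $M/G/1/1$ system. *)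

theory Defs
  imports "HOL-Probability.Probability"
begin

text \<open>
  \<open>T j\<close> is the epoch of the \<open>j\<close>-th point (counted from 0) of a point process on
  \<open>(0, \<infinity>)\<close>; the origin serves as the predecessor of the first point.
\<close>

definition gap :: "(nat \<Rightarrow> 'a \<Rightarrow> real) \<Rightarrow> nat \<Rightarrow> 'a \<Rightarrow> real" where
  "gap T j \<omega> = T j \<omega> - (if j = 0 then 0 else T (j - 1) \<omega>)"

definition poisson_process :: "'a measure \<Rightarrow> real \<Rightarrow> (nat \<Rightarrow> 'a \<Rightarrow> real) \<Rightarrow> bool" where
  "poisson_process M l T \<longleftrightarrow>
     prob_space.indep_vars M (\<lambda>_. borel) (gap T) UNIV \<and>
     (\<forall>j. distributed M lborel (gap T j) (exponential_density l))"

text \<open>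
  The sample-path functions below take a realisation of the arrival epochs \<open>a\<close> and of the service
  requirements \<open>s\<close>: packet \<open>(k, j)\<close> is the \<open>j\<close>-th packet of class \<open>k\<close>; it arrives at time
  \<open>a k j\<close> and, if admitted, is served for \<open>s k j\<close> time units.
\<close>

definition next_arrival :: "nat \<Rightarrow> (nat \<Rightarrow> nat \<Rightarrow> real) \<Rightarrow> real \<Rightarrow> nat \<times> nat" where
  "next_arrival N a t =
     (ARG_MIN (\<lambda>(k, j). a k j) p. p \<in> {1..N} \<times> UNIV \<and> t < a (fst p) (snd p))"

text \<open>
  \<open>served N a s m\<close> is the \<open>m\<close>-th packet admitted to the server, which is idle at time 0. When an
  admitted packet departs the server stays idle until the next arrival of any class, and that
  packet is admitted; all arrivals in between found the server busy and are discarded. An arrival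
  at the very instant of a departure, or simultaneous arrivals, are resolved arbitrarily; these
  have probability zero for independent Poisson arrivals.
\<close>

primrec served ::
  "nat \<Rightarrow> (nat \<Rightarrow> nat \<Rightarrow> real) \<Rightarrow> (nat \<Rightarrow> nat \<Rightarrow> real) \<Rightarrow> nat \<Rightarrow> nat \<times> nat" where
  "served N a s 0 = next_arrival N a 0"
| "served N a s (Suc m) =
     next_arrival N a (case served N a s m of (k, j) \<Rightarrow> a k j + s k j)"

definition generation_time ::
  "nat \<Rightarrow> (nat \<Rightarrow> nat \<Rightarrow> real) \<Rightarrow> (nat \<Rightarrow> nat \<Rightarrow> real) \<Rightarrow> nat \<Rightarrow> real" where
  "generation_time N a s m = (case served N a s m of (k, j) \<Rightarrow> a k j)"

definition reception_time ::
  "nat \<Rightarrow> (nat \<Rightarrow> nat \<Rightarrow> real) \<Rightarrow> (nat \<Rightarrow> nat \<Rightarrow> real) \<Rightarrow> nat \<Rightarrow> real" where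
  "reception_time N a s m = (case served N a s m of (k, j) \<Rightarrow> a k j + s k j)"

definition class_served ::
  "nat \<Rightarrow> (nat \<Rightarrow> nat \<Rightarrow> real) \<Rightarrow> (nat \<Rightarrow> nat \<Rightarrow> real) \<Rightarrow> nat \<Rightarrow> nat set" where
  "class_served N a s n = {m. fst (served N a s m) = n}"

text \<open>
  Before the first reception of a class-\<open>n\<close> packet the age grows at unit rate from its
  initial value \<open>\<delta>\<close>. Packets are received in the order in which they are admitted, so the latest
  received one is the one with the greatest admission number.
\<close>

definition status_age ::
  "nat \<Rightarrow> (nat \<Rightarrow> nat \<Rightarrow> real) \<Rightarrow> (nat \<Rightarrow> nat \<Rightarrow> real) \<Rightarrow> real \<Rightarrow> nat \<Rightarrow> real \<Rightarrow> real" where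
  "status_age N a s \<delta> n t =
     (if \<exists>m\<in>class_served N a s n. reception_time N a s m \<le> t
      then t - generation_time N a s
                 (GREATEST m. m \<in> class_served N a s n \<and> reception_time N a s m \<le> t)
      else \<delta> + t)"

text \<open>
  Peaks are counted from 0; almost surely every class is served infinitely often, so that
  \<open>enumerate\<close> lists the admission numbers of all its received packets in increasing order.
\<close>

definition peak_age ::
  "nat \<Rightarrow> (nat \<Rightarrow> nat \<Rightarrow> real) \<Rightarrow> (nat \<Rightarrow> nat \<Rightarrow> real) \<Rightarrow> real \<Rightarrow> nat \<Rightarrow> nat \<Rightarrow> real" where
  "peak_age N a s \<delta> n k =
     Lim (at_left (reception_time N a s (enumerate (class_served N a s n) k)))
         (status_age N a s \<delta> n)"

definition has_peak_aoi ::
  "nat \<Rightarrow> (nat \<Rightarrow> nat \<Rightarrow> real) \<Rightarrow> (nat \<Rightarrow> nat \<Rightarrow> real) \<Rightarrow> real \<Rightarrow> nat \<Rightarrow> real \<Rightarrow> bool" where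
  "has_peak_aoi N a s \<delta> n A \<longleftrightarrow>
     (\<lambda>K. (\<Sum>k<K. peak_age N a s \<delta> n k) / real K) \<longlonglongrightarrow> A"

end

theory Submission
  imports Defs
begin

text \<open>
  Let \<open>\<Lambda>\<close> be the sum of the arrival rates. The evolution splits into cycles, each consisting of an
  idle period followed by one service. Because Poisson processes have no memory, all arrival
  streams start afresh, independently of the past, when a packet departs: the residual streams
  have the law of the original ones, although services of different classes last for different
  times and although the departure instant depends on the arrivals. Hence the triples (class, idle
  time, service time) of the successive cycles are pairwise independent and identically
  distributed: the idle time is exponential with rate \<open>\<Lambda>\<close>, the class is \<open>k\<close> with probability
  \<open>lam k / \<Lambda>\<close>, independently of the idle time, and the service time has the law of class \<open>k\<close>.

  The peak of the age of class \<open>n\<close> that ends with the reception of a packet is its reception time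
  minus the generation time of the preceding admitted class-\<open>n\<close> packet, so it is the time between
  two successive class-\<open>n\<close> generations plus one class-\<open>n\<close> service. A sum of such peaks telescopes,
  and the strong law of large numbers, applied to the idle times, the service times, the indicator
  of class \<open>n\<close> and the class-\<open>n\<close> service times along the cycles, yields the limit
  \<open>x n + (1 / \<Lambda> + (\<Sum>k. lam k * x k) / \<Lambda>) / (lam n / \<Lambda>)\<close>.

  The service times have only a first moment, so the strong law is needed in the form
  of Etemadi, for pairwise independent integrable variables (\<open>strong_law\<close>). Pairwise independence
  is also what the regeneration gives most directly (\<open>indep_cycles\<close>): it suffices that the first
  triple is independent of the restarted streams and that restarting preserves their law
  (\<open>nn_integral_head_restart\<close>). That the packets admitted by the queue are exactly the first
  points of the successively restarted streams is \<open>served_cycle\<close>.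
\<close>

section \<open>The strong law for pairwise independent variables\<close>

text \<open>
  The last term of a geometric progression dominates the sum of all earlier ones; with
  \<open>geometric_sum_above\<close> this makes the error bounds of \<open>block_deviation\<close> summable along a geometric
  sequence of block lengths. The factor 2 in the second lemma is the loss from rounding \<open>\<alpha> ^ n\<close> up
  to an integer.
\<close>

lemma geometric_sum_below:
  fixes \<alpha> y :: real
  assumes "1 < \<alpha>" "0 \<le> y"
  shows "(\<Sum>n<M. if \<alpha> ^ n < y then \<alpha> ^ n else 0) \<le> \<alpha> / (\<alpha> - 1) * y"
proof (induction M)
  case 0
  then show ?case using assms by simp
next
  case (Suc M)
  show ?case
  proof (cases "\<alpha> ^ M < y")
    case True
    have "(\<Sum>n<Suc M. if \<alpha> ^ n < y then \<alpha> ^ n else 0) \<le> (\<Sum>n<Suc M. \<alpha> ^ n)"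
      using assms by (intro sum_mono) auto
    also have "\<dots> = (\<alpha> ^ Suc M - 1) / (\<alpha> - 1)"
      using assms by (subst geometric_sum) auto
    also have "\<dots> \<le> \<alpha> * y / (\<alpha> - 1)"
      using assms True by (intro divide_right_mono) (auto intro: order_trans[OF _ mult_left_mono[of "\<alpha> ^ M" y \<alpha>]])
    finally show ?thesis by simp
  next
    case False
    then show ?thesis using Suc by simp
  qed
qed

lemma geometric_sum_above:
  fixes \<alpha> y :: real
  assumes "1 < \<alpha>" "0 < y"
  shows "(\<Sum>n<M. if y \<le> 2 * \<alpha> ^ n then 1 / \<alpha> ^ n else 0) \<le> 2 * \<alpha> / (\<alpha> - 1) / y"
  using assms(2)
proof (induction M arbitrary: y)
  case 0
  then show ?case using assms by simp
next
  case (Suc M)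
  show ?case
  proof (cases "y \<le> 2")
    case True
    have "(\<Sum>n<Suc M. if y \<le> 2 * \<alpha> ^ n then 1 / \<alpha> ^ n else 0) \<le> (\<Sum>n<Suc M. (1 / \<alpha>) ^ n)"
      using assms by (intro sum_mono) (auto simp: power_divide)
    also have "\<dots> \<le> (\<Sum>n. (1 / \<alpha>) ^ n)"
      using assms by (intro sum_le_suminf summable_geometric) auto
    also have "\<dots> = \<alpha> / (\<alpha> - 1)"
      using assms by (subst suminf_geometric) (auto simp: field_simps)
    also have "\<dots> \<le> \<alpha> / (\<alpha> - 1) * (2 / y)"
      using assms True Suc.prems mult_left_mono[of 1 "2 / y" "\<alpha> / (\<alpha> - 1)"] by simp
    finally show ?thesis by (simp add: mult_ac)
  next
    case False
    have "(\<Sum>n<Suc M. if y \<le> 2 * \<alpha> ^ n then 1 / \<alpha> ^ n else 0) =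
        (\<Sum>n<M. 1 / \<alpha> * (if y / \<alpha> \<le> 2 * \<alpha> ^ n then 1 / \<alpha> ^ n else 0))"
      using False assms by (subst sum.lessThan_Suc_shift) (auto intro!: sum.cong simp: field_simps)
    also have "\<dots> = 1 / \<alpha> * (\<Sum>n<M. (if y / \<alpha> \<le> 2 * \<alpha> ^ n then 1 / \<alpha> ^ n else 0))"
      by (simp add: sum_distrib_left)
    also have "\<dots> \<le> 1 / \<alpha> * (2 * \<alpha> / (\<alpha> - 1) / (y / \<alpha>))"
      using assms Suc.prems by (intro mult_left_mono Suc.IH) auto
    also have "\<dots> = 2 * \<alpha> / (\<alpha> - 1) / y"
      using assms Suc.prems by simp
    finally show ?thesis .
  qed
qed

lemma (in prob_space) variance_sum_pairwise_indep:
  fixes Z :: "'i \<Rightarrow> 'a \<Rightarrow> real"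
  assumes "finite I"
    and sq: "\<And>i. i \<in> I \<Longrightarrow> integrable M (\<lambda>\<omega>. (Z i \<omega>)\<^sup>2)"
    and rv: "\<And>i. i \<in> I \<Longrightarrow> random_variable borel (Z i)"
    and indep: "\<And>i j. i \<in> I \<Longrightarrow> j \<in> I \<Longrightarrow> i \<noteq> j \<Longrightarrow> indep_var borel (Z i) borel (Z j)"
  shows "variance (\<lambda>\<omega>. \<Sum>i\<in>I. Z i \<omega>) = (\<Sum>i\<in>I. variance (Z i))"
    and "integrable M (\<lambda>\<omega>. (\<Sum>i\<in>I. Z i \<omega>)\<^sup>2)"
proof -
  have int: "integrable M (Z i)" if "i \<in> I" for i
    using square_integrable_imp_integrable[OF rv[OF that] sq[OF that]] .
  define C where "C i \<omega> = Z i \<omega> - expectation (Z i)" for i \<omega>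
  have C_sq: "integrable M (\<lambda>\<omega>. C i \<omega> * C i \<omega>)" if "i \<in> I" for i
    using int[OF that] sq[OF that] unfolding C_def
    by (simp add: algebra_simps power2_eq_square)
  have Cint: "integrable M (C i)" if "i \<in> I" for i
    using int[OF that] unfolding C_def by simp
  have ind: "indep_var borel (C i) borel (C j)" if "i \<in> I" "j \<in> I" "i \<noteq> j" for i j
    using indep_var_compose[OF indep[OF that], of "\<lambda>x. x - expectation (Z i)" borel "\<lambda>x. x - expectation (Z j)" borel]
    by (simp add: comp_def C_def[abs_def])
  have Cprod: "integrable M (\<lambda>\<omega>. C i \<omega> * C j \<omega>)" if "i \<in> I" "j \<in> I" for i j
    using that C_sq indep_var_integrable[OF ind Cint Cint] by (cases "i = j") auto
  have C0: "expectation (C i) = 0" if "i \<in> I" for i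
    using int[OF that] unfolding C_def by (simp add: prob_space)
  have cov: "expectation (\<lambda>\<omega>. C i \<omega> * C j \<omega>) = (if i = j then variance (Z i) else 0)" if "i \<in> I" "j \<in> I" for i j
  proof (cases "i = j")
    case True
    then show ?thesis by (simp add: C_def power2_eq_square)
  next
    case False
    then show ?thesis
      using that indep_var_lebesgue_integral[OF ind Cint Cint, of i j] C0 by simp
  qed
  have centred: "(\<lambda>\<omega>. (\<Sum>i\<in>I. Z i \<omega>) - expectation (\<lambda>\<omega>. \<Sum>i\<in>I. Z i \<omega>)) = (\<lambda>\<omega>. \<Sum>i\<in>I. C i \<omega>)"
    using int by (simp add: C_def sum_subtractf)
  have *: "((\<Sum>i\<in>I. Z i \<omega>) - expectation (\<lambda>\<omega>. \<Sum>i\<in>I. Z i \<omega>))\<^sup>2 = (\<Sum>i\<in>I. \<Sum>j\<in>I. C i \<omega> * C j \<omega>)" for \<omega>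
    using fun_cong[OF centred, of \<omega>] by (simp only: power2_eq_square sum_product)
  have "variance (\<lambda>\<omega>. \<Sum>i\<in>I. Z i \<omega>) = (\<Sum>i\<in>I. \<Sum>j\<in>I. expectation (\<lambda>\<omega>. C i \<omega> * C j \<omega>))"
    unfolding * using Cprod by (simp add: integrable_sum)
  also have "\<dots> = (\<Sum>i\<in>I. variance (Z i))"
    using \<open>finite I\<close> by (intro sum.cong) (simp_all add: cov)
  finally show "variance (\<lambda>\<omega>. \<Sum>i\<in>I. Z i \<omega>) = (\<Sum>i\<in>I. variance (Z i))" .
  have "integrable M (\<lambda>\<omega>. Z i \<omega> * Z j \<omega>)" if "i \<in> I" "j \<in> I" for i j
    using that sq[of i] indep_var_integrable[OF indep int int]
    by (cases "i = j") (auto simp: power2_eq_square)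
  then show "integrable M (\<lambda>\<omega>. (\<Sum>i\<in>I. Z i \<omega>)\<^sup>2)"
    by (simp add: power2_eq_square sum_product)
qed

locale pairwise_iid = prob_space +
  fixes X :: "nat \<Rightarrow> 'a \<Rightarrow> real"
  assumes integrable: "\<And>i. integrable M (X i)"
    and distr_eq: "\<And>i. distr M borel (X i) = distr M borel (X 0)"
    and pairwise_indep: "\<And>i j. i \<noteq> j \<Longrightarrow> indep_var borel (X i) borel (X j)"
begin

lemma random_variable_X [measurable]: "random_variable borel (X i)"
  using integrable by auto

lemma expectation_compose:
  assumes [measurable]: "f \<in> borel_measurable borel"
  shows "expectation (\<lambda>\<omega>. f (X i \<omega>)) = (expectation (\<lambda>\<omega>. f (X 0 \<omega>)) :: real)"
proof -
  have "expectation (\<lambda>\<omega>. f (X i \<omega>)) = (\<integral>x. f x \<partial>distr M borel (X i))"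
    by (simp add: integral_distr)
  also have "\<dots> = expectation (\<lambda>\<omega>. f (X 0 \<omega>))"
    unfolding distr_eq[of i] by (simp add: integral_distr)
  finally show ?thesis .
qed

lemma prob_compose:
  assumes [measurable]: "A \<in> sets borel"
  shows "prob {\<omega> \<in> space M. X i \<omega> \<in> A} = prob {\<omega> \<in> space M. X 0 \<omega> \<in> A}"
proof -
  have "prob {\<omega> \<in> space M. X i \<omega> \<in> A} = measure (distr M borel (X i)) A" for i
    by (simp add: measure_distr vimage_def Int_def conj_commute)
  then show ?thesis by (simp add: distr_eq[of i])
qed

end

definition truncate :: "real \<Rightarrow> real \<Rightarrow> real" where
  "truncate c x = (if x \<le> c then x else 0)"

lemma measurable_truncate [measurable]: "truncate c \<in> borel_measurable borel"
  unfolding truncate_def by measurable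

locale nonneg_pairwise_iid = pairwise_iid +
  assumes nonneg: "\<And>i \<omega>. 0 \<le> X i \<omega>"
begin

lemma integrable_truncate: "0 \<le> c \<Longrightarrow> integrable M (\<lambda>\<omega>. truncate c (X i \<omega>))"
  by (rule integrable_const_bound[where B=c]) (auto simp: truncate_def nonneg)

lemma integrable_truncate_square: "0 \<le> c \<Longrightarrow> integrable M (\<lambda>\<omega>. (truncate c (X i \<omega>))\<^sup>2)"
  by (rule integrable_const_bound[where B="c\<^sup>2"]) (auto simp: truncate_def nonneg intro: power_mono)

text \<open>
  Truncation at the block length \<open>K\<close> makes the variance finite. The truncated sum is controlled by
  Chebyshev's inequality, for which pairwise independence is enough, and it differs from the
  original sum only if one of the \<open>K\<close> terms exceeds \<open>K\<close>.
\<close>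

lemma block_deviation:
  assumes K: "0 < K" and \<epsilon>: "0 < \<epsilon>"
  defines "m \<equiv> expectation (\<lambda>\<omega>. truncate (real K) (X 0 \<omega>))"
  shows "prob {\<omega> \<in> space M. \<epsilon> \<le> \<bar>(\<Sum>i<K. X i \<omega>) / real K - m\<bar>} \<le>
    real K * prob {\<omega> \<in> space M. real K < X 0 \<omega>} +
    expectation (\<lambda>\<omega>. (truncate (real K) (X 0 \<omega>))\<^sup>2) / (\<epsilon>\<^sup>2 * real K)"
proof -
  define Z where "Z i \<omega> = truncate (real K) (X i \<omega>)" for i \<omega>
  have [measurable]: "random_variable borel (Z i)" for i
    unfolding Z_def by measurable
  let ?S = "\<lambda>\<omega>. \<Sum>i<K. Z i \<omega>"
  let ?A = "{\<omega> \<in> space M. \<epsilon> * real K \<le> \<bar>?S \<omega> - expectation ?S\<bar>}"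
  let ?B = "\<lambda>i. {\<omega> \<in> space M. real K < X i \<omega>}"
  have ind: "indep_var borel (Z i) borel (Z j)" if "i \<noteq> j" for i j
    using indep_var_compose[OF pairwise_indep[OF that], of "truncate (real K)" borel "truncate (real K)" borel]
    by (simp add: comp_def Z_def[abs_def])
  have sq: "integrable M (\<lambda>\<omega>. (Z i \<omega>)\<^sup>2)" for i
    unfolding Z_def by (rule integrable_truncate_square) simp
  have int: "integrable M (Z i)" for i
    unfolding Z_def by (rule integrable_truncate) simp
  have mean: "expectation (Z i) = m" for i
    unfolding Z_def m_def by (rule expectation_compose) simp
  have meanS: "expectation ?S = real K * m"
    using int by (simp add: mean)
  have "variance (Z i) \<le> expectation (\<lambda>\<omega>. (truncate (real K) (X 0 \<omega>))\<^sup>2)" for i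
  proof -
    have "variance (Z i) \<le> expectation (\<lambda>\<omega>. (Z i \<omega>)\<^sup>2)"
      using int sq by (simp add: variance_eq)
    also have "\<dots> = expectation (\<lambda>\<omega>. (truncate (real K) (X 0 \<omega>))\<^sup>2)"
      unfolding Z_def by (rule expectation_compose) simp
    finally show ?thesis .
  qed
  then have var: "variance ?S \<le> real K * expectation (\<lambda>\<omega>. (truncate (real K) (X 0 \<omega>))\<^sup>2)"
    using variance_sum_pairwise_indep(1)[of "{..<K}" Z] sq ind
      sum_mono[of "{..<K}" "\<lambda>i. variance (Z i)" "\<lambda>_. expectation (\<lambda>\<omega>. (truncate (real K) (X 0 \<omega>))\<^sup>2)"]
    by simp
  have "prob {\<omega> \<in> space M. \<epsilon> \<le> \<bar>(\<Sum>i<K. X i \<omega>) / real K - m\<bar>} \<le> prob (?A \<union> (\<Union>i<K. ?B i))"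
  proof (rule finite_measure_mono)
    show "{\<omega> \<in> space M. \<epsilon> \<le> \<bar>(\<Sum>i<K. X i \<omega>) / real K - m\<bar>} \<subseteq> ?A \<union> (\<Union>i<K. ?B i)"
    proof
      fix \<omega> assume *: "\<omega> \<in> {\<omega> \<in> space M. \<epsilon> \<le> \<bar>(\<Sum>i<K. X i \<omega>) / real K - m\<bar>}"
      show "\<omega> \<in> ?A \<union> (\<Union>i<K. ?B i)"
      proof (rule ccontr)
        assume **: "\<omega> \<notin> ?A \<union> (\<Union>i<K. ?B i)"
        from * have \<omega>: "\<omega> \<in> space M" and dev: "\<epsilon> \<le> \<bar>(\<Sum>i<K. X i \<omega>) / real K - m\<bar>"
          by simp_all
        have "X i \<omega> \<le> real K" if "i < K" for i
          using ** \<omega> that by (simp add: not_less)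
        then have sum_eq: "(\<Sum>i<K. X i \<omega>) = ?S \<omega>"
          by (intro sum.cong) (auto simp: Z_def truncate_def)
        have "(\<Sum>i<K. X i \<omega>) / real K - m = (?S \<omega> - expectation ?S) / real K"
          unfolding sum_eq meanS using K by (simp add: diff_divide_distrib)
        with dev K have "\<epsilon> * real K \<le> \<bar>?S \<omega> - expectation ?S\<bar>"
          by (simp add: abs_divide pos_le_divide_eq)
        with \<omega> have "\<omega> \<in> ?A" by blast
        with ** show False by blast
      qed
    qed
  qed measurable
  also have "\<dots> \<le> prob ?A + prob (\<Union>i<K. ?B i)"
    by (rule measure_Un_le) measurable
  also have "prob ?A \<le> variance ?S / (\<epsilon> * real K)\<^sup>2"
    using K \<epsilon> sq ind by (intro Chebyshev_inequality variance_sum_pairwise_indep(2)) auto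
  also have "\<dots> \<le> real K * expectation (\<lambda>\<omega>. (truncate (real K) (X 0 \<omega>))\<^sup>2) / (\<epsilon> * real K)\<^sup>2"
    using var by (rule divide_right_mono) simp
  also have "\<dots> = expectation (\<lambda>\<omega>. (truncate (real K) (X 0 \<omega>))\<^sup>2) / (\<epsilon>\<^sup>2 * real K)"
    using K by (simp add: power2_eq_square)
  also have "prob (\<Union>i<K. ?B i) \<le> (\<Sum>i<K. prob (?B i))"
    by (rule finite_measure_subadditive_finite) auto
  also have "\<dots> = (\<Sum>i<K. prob (?B 0))"
  proof (rule sum.cong)
    fix i show "prob (?B i) = prob (?B 0)"
      using prob_compose[of "{real K<..}" i] by simp
  qed simp
  finally show ?thesis by simp
qed

text \<open>
  Along the block lengths \<open>\<lceil>\<alpha> ^ n\<rceil>\<close> both error terms of \<open>block_deviation\<close> are summable: after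
  interchanging sum and expectation, each is a geometric sum cut off at the value of \<open>X 0\<close>, hence at
  most a constant times \<open>X 0\<close>. The Borel-Cantelli lemma then gives almost sure convergence.
\<close>

lemma averages_along_powers:
  fixes \<alpha> :: real
  assumes \<alpha>: "1 < \<alpha>"
  shows "AE \<omega> in M. (\<lambda>n. (\<Sum>i<nat \<lceil>\<alpha> ^ n\<rceil>. X i \<omega>) / real (nat \<lceil>\<alpha> ^ n\<rceil>)) \<longlonglongrightarrow> expectation (X 0)"
proof -
  define k where "k n = nat \<lceil>\<alpha> ^ n\<rceil>" for n
  have \<alpha>1: "1 \<le> \<alpha> ^ n" for n using \<alpha> by simp
  have k_ge: "\<alpha> ^ n \<le> real (k n)" for n
    unfolding k_def by linarith
  have k_le: "real (k n) \<le> 2 * \<alpha> ^ n" for n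
    unfolding k_def using \<alpha>1[of n] by linarith
  have k_pos: "0 < k n" for n
    using k_ge[of n] \<alpha>1[of n] by (cases "k n") auto
  define m where "m n = expectation (\<lambda>\<omega>. truncate (real (k n)) (X 0 \<omega>))" for n
  define p where "p n = real (k n) * prob {\<omega> \<in> space M. real (k n) < X 0 \<omega>}" for n
  define v where "v n = expectation (\<lambda>\<omega>. (truncate (real (k n)) (X 0 \<omega>))\<^sup>2) / real (k n)" for n
  have k_lim: "filterlim (\<lambda>n. real (k n)) at_top sequentially"
    using k_ge \<alpha> by (intro filterlim_at_top_mono[OF filterlim_realpow_sequentially_gt1[of \<alpha>, unfolded filterlim_at_infinity_conv_norm_at_top]]) (auto simp: abs_of_pos)
  have p_sum: "summable p"
  proof (rule summableI_nonneg_bounded)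
    show "0 \<le> p n" for n by (simp add: p_def)
    fix N
    have int: "integrable M (\<lambda>\<omega>. real (k n) * indicator {\<omega> \<in> space M. real (k n) < X 0 \<omega>} \<omega>)" for n
      by (intro integrable_mult_right integrable_real_indicator) (auto simp: emeasure_eq_measure)
    have "(\<Sum>n<N. p n) = (\<Sum>n<N. expectation (\<lambda>\<omega>. real (k n) * indicator {\<omega> \<in> space M. real (k n) < X 0 \<omega>} \<omega>))"
      by (simp add: p_def)
    also have "\<dots> = expectation (\<lambda>\<omega>. \<Sum>n<N. real (k n) * indicator {\<omega> \<in> space M. real (k n) < X 0 \<omega>} \<omega>)"
      by (rule Bochner_Integration.integral_sum[symmetric]) (rule int)
    also have "\<dots> \<le> expectation (\<lambda>\<omega>. 2 * (\<alpha> / (\<alpha> - 1) * X 0 \<omega>))"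
    proof (rule integral_mono)
      fix \<omega> assume "\<omega> \<in> space M"
      have "(\<Sum>n<N. real (k n) * indicator {\<omega> \<in> space M. real (k n) < X 0 \<omega>} \<omega>) \<le>
          (\<Sum>n<N. 2 * (if \<alpha> ^ n < X 0 \<omega> then \<alpha> ^ n else 0))"
        using k_le k_ge \<alpha> by (intro sum_mono) (auto simp: indicator_def dest: le_less_trans[OF k_ge])
      also have "\<dots> \<le> 2 * (\<alpha> / (\<alpha> - 1) * X 0 \<omega>)"
        unfolding sum_distrib_left[symmetric]
        by (intro mult_left_mono geometric_sum_below \<alpha> nonneg) simp
      finally show "(\<Sum>n<N. real (k n) * indicator {\<omega> \<in> space M. real (k n) < X 0 \<omega>} \<omega>) \<le> 2 * (\<alpha> / (\<alpha> - 1) * X 0 \<omega>)" .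
    qed (intro Bochner_Integration.integrable_sum int, use integrable in simp)
    finally show "(\<Sum>n<N. p n) \<le> expectation (\<lambda>\<omega>. 2 * (\<alpha> / (\<alpha> - 1) * X 0 \<omega>))" .
  qed
  have v_sum: "summable v"
  proof (rule summableI_nonneg_bounded)
    show "0 \<le> v n" for n by (simp add: v_def)
    fix N
    have int: "integrable M (\<lambda>\<omega>. (truncate (real (k n)) (X 0 \<omega>))\<^sup>2 / real (k n))" for n
      by (intro integrable_divide integrable_truncate_square) simp
    have "(\<Sum>n<N. v n) = expectation (\<lambda>\<omega>. \<Sum>n<N. (truncate (real (k n)) (X 0 \<omega>))\<^sup>2 / real (k n))"
      using int by (subst Bochner_Integration.integral_sum) (simp_all add: v_def)
    also have "\<dots> \<le> expectation (\<lambda>\<omega>. 2 * \<alpha> / (\<alpha> - 1) * X 0 \<omega>)"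
    proof (rule integral_mono)
      fix \<omega> assume "\<omega> \<in> space M"
      show "(\<Sum>n<N. (truncate (real (k n)) (X 0 \<omega>))\<^sup>2 / real (k n)) \<le> 2 * \<alpha> / (\<alpha> - 1) * X 0 \<omega>"
      proof (cases "X 0 \<omega> = 0")
        case True
        then show ?thesis by (simp add: truncate_def)
      next
        case False
        then have pos: "0 < X 0 \<omega>" using nonneg[of 0 \<omega>] by simp
        have "(\<Sum>n<N. (truncate (real (k n)) (X 0 \<omega>))\<^sup>2 / real (k n)) \<le>
            (\<Sum>n<N. (X 0 \<omega>)\<^sup>2 * (if X 0 \<omega> \<le> 2 * \<alpha> ^ n then 1 / \<alpha> ^ n else 0))"
        proof (rule sum_mono)
          fix n
          have "(X 0 \<omega>)\<^sup>2 / real (k n) \<le> (X 0 \<omega>)\<^sup>2 / \<alpha> ^ n"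
            using k_ge[of n] k_pos[of n] \<alpha> by (intro divide_left_mono) auto
          then show "(truncate (real (k n)) (X 0 \<omega>))\<^sup>2 / real (k n) \<le>
              (X 0 \<omega>)\<^sup>2 * (if X 0 \<omega> \<le> 2 * \<alpha> ^ n then 1 / \<alpha> ^ n else 0)"
            using k_le[of n] \<alpha> by (auto simp: truncate_def)
        qed
        also have "\<dots> \<le> (X 0 \<omega>)\<^sup>2 * (2 * \<alpha> / (\<alpha> - 1) / X 0 \<omega>)"
          unfolding sum_distrib_left[symmetric]
          by (intro mult_left_mono geometric_sum_above \<alpha> pos) simp
        also have "\<dots> = 2 * \<alpha> / (\<alpha> - 1) * X 0 \<omega>"
          using pos by (simp add: power2_eq_square)
        finally show ?thesis .
      qed
    qed (use int integrable in auto)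
    finally show "(\<Sum>n<N. v n) \<le> expectation (\<lambda>\<omega>. 2 * \<alpha> / (\<alpha> - 1) * X 0 \<omega>)" .
  qed
  \<comment> \<open>the truncated means recover the mean, since the truncation level tends to infinity\<close>
  have m_lim: "m \<longlonglongrightarrow> expectation (X 0)"
    unfolding m_def
  proof (rule integral_dominated_convergence[where w="X 0"])
    show "AE \<omega> in M. (\<lambda>n. truncate (real (k n)) (X 0 \<omega>)) \<longlonglongrightarrow> X 0 \<omega>"
    proof (rule AE_I2)
      fix \<omega>
      have "eventually (\<lambda>n. X 0 \<omega> \<le> real (k n)) sequentially"
        using k_lim by (simp add: filterlim_at_top)
      then show "(\<lambda>n. truncate (real (k n)) (X 0 \<omega>)) \<longlonglongrightarrow> X 0 \<omega>"
        by (intro tendsto_eventually) (auto simp: truncate_def elim: eventually_mono)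
    qed
  qed (use integrable nonneg in \<open>auto simp: truncate_def\<close>)
  have dev: "AE \<omega> in M. eventually (\<lambda>n. \<bar>(\<Sum>i<k n. X i \<omega>) / real (k n) - m n\<bar> < \<epsilon>) sequentially"
    if "0 < \<epsilon>" for \<epsilon> :: real
  proof -
    let ?A = "\<lambda>n. {\<omega> \<in> space M. \<epsilon> \<le> \<bar>(\<Sum>i<k n. X i \<omega>) / real (k n) - m n\<bar>}"
    have "AE \<omega> in M. eventually (\<lambda>n. \<omega> \<in> space M - ?A n) sequentially"
    proof (rule borel_cantelli_AE1)
      show "summable (\<lambda>n. prob (?A n))"
      proof (rule summable_comparison_test'[where N=0])
        show "summable (\<lambda>n. p n + v n / \<epsilon>\<^sup>2)"
          using p_sum v_sum by (intro summable_add summable_divide)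
        show "norm (prob (?A n)) \<le> p n + v n / \<epsilon>\<^sup>2" for n
          using block_deviation[OF k_pos[of n] that] by (simp add: m_def p_def v_def mult.commute)
      qed
    qed (simp_all add: emeasure_eq_measure)
    then show ?thesis
      by eventually_elim (auto elim!: eventually_mono)
  qed
  have "AE \<omega> in M. \<forall>j. eventually (\<lambda>n. \<bar>(\<Sum>i<k n. X i \<omega>) / real (k n) - m n\<bar> < inverse (real (Suc j))) sequentially"
    unfolding AE_all_countable by (intro allI dev) simp
  then show ?thesis
  proof eventually_elim
    fix \<omega>
    assume *: "\<forall>j. eventually (\<lambda>n. \<bar>(\<Sum>i<k n. X i \<omega>) / real (k n) - m n\<bar> < inverse (real (Suc j))) sequentially"
    have "(\<lambda>n. (\<Sum>i<k n. X i \<omega>) / real (k n) - m n) \<longlonglongrightarrow> 0"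
    proof (rule tendstoI)
      fix e :: real assume "0 < e"
      then obtain j where "inverse (real (Suc j)) < e"
        using reals_Archimedean by blast
      with *[rule_format, of j] show "eventually (\<lambda>n. dist ((\<Sum>i<k n. X i \<omega>) / real (k n) - m n) 0 < e) sequentially"
        by (auto elim!: eventually_mono)
    qed
    from tendsto_add[OF this m_lim] show "(\<lambda>n. (\<Sum>i<nat \<lceil>\<alpha> ^ n\<rceil>. X i \<omega>) / real (nat \<lceil>\<alpha> ^ n\<rceil>)) \<longlonglongrightarrow> expectation (X 0)"
      by (simp add: k_def)
  qed
qed

end

text \<open>
  For nonnegative terms the partial sums are monotone. Between two consecutive block lengths their
  averages therefore vary by a factor of at most about \<open>\<alpha>\<close>, and \<open>\<alpha>\<close> can be taken arbitrarily
  close to 1.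
\<close>

lemma averages_from_powers:
  fixes x :: "nat \<Rightarrow> real"
  assumes nonneg: "\<And>i. 0 \<le> x i"
    and lim: "\<And>j. (\<lambda>n. (\<Sum>i<nat \<lceil>(1 + inverse (real (Suc j))) ^ n\<rceil>. x i) /
      real (nat \<lceil>(1 + inverse (real (Suc j))) ^ n\<rceil>)) \<longlonglongrightarrow> \<mu>"
  shows "(\<lambda>m. (\<Sum>i<m. x i) / real m) \<longlonglongrightarrow> \<mu>"
proof -
  define \<alpha> where "\<alpha> j = 1 + inverse (real (Suc j))" for j
  have \<alpha>: "1 < \<alpha> j" for j by (simp add: \<alpha>_def)
  have \<alpha>_lim: "\<alpha> \<longlonglongrightarrow> 1"
    unfolding \<alpha>_def using tendsto_add[OF tendsto_const LIMSEQ_inverse_real_of_nat, of 1] by simp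
  define k where "k j n = nat \<lceil>\<alpha> j ^ n\<rceil>" for j n
  define A where "A m = (\<Sum>i<m. x i) / real m" for m
  \<comment> \<open>\<open>\<alpha> j ^ e j m\<close> is the largest power of \<open>\<alpha> j\<close> that does not exceed \<open>m\<close>\<close>
  define e where "e j m = nat \<lfloor>log (\<alpha> j) (real m)\<rfloor>" for j m
  have A_lim: "(\<lambda>n. A (k j n)) \<longlonglongrightarrow> \<mu>" for j
    using lim[of j] by (simp add: A_def k_def \<alpha>_def)
  have e_bounds: "\<alpha> j ^ e j m \<le> real m" "real m < \<alpha> j ^ Suc (e j m)" if "0 < m" for j m
  proof -
    have log0: "0 \<le> log (\<alpha> j) (real m)"
      using \<alpha>[of j] that by simp
    then have "real (e j m) \<le> log (\<alpha> j) (real m)" "log (\<alpha> j) (real m) < real (Suc (e j m))"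
      unfolding e_def by linarith+
    then have "\<alpha> j powr real (e j m) \<le> real m" "real m < \<alpha> j powr real (Suc (e j m))"
      using \<alpha>[of j] that by (simp_all add: le_log_iff log_less_iff)
    then show "\<alpha> j ^ e j m \<le> real m" "real m < \<alpha> j ^ Suc (e j m)"
      using \<alpha>[of j] by (simp_all only: powr_realpow)
  qed
  have e_lim: "filterlim (e j) at_top sequentially" for j
  proof (unfold filterlim_at_top, rule allI)
    fix N
    have "N \<le> e j m" if "\<alpha> j ^ N \<le> real m" "0 < m" for m
    proof (rule ccontr)
      assume "\<not> N \<le> e j m"
      then have "\<alpha> j ^ Suc (e j m) \<le> \<alpha> j ^ N"
        using \<alpha>[of j] by (intro power_increasing) auto
      with e_bounds(2)[OF that(2), of j] that(1) show False by simp
    qed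
    moreover have "eventually (\<lambda>m. \<alpha> j ^ N \<le> real m \<and> 0 < m) sequentially"
      using filterlim_real_sequentially eventually_gt_at_top[of 0]
      by (auto simp: filterlim_at_top intro: eventually_conj)
    ultimately show "eventually (\<lambda>m. N \<le> e j m) sequentially"
      by (auto elim: eventually_mono)
  qed
  have mono: "(\<Sum>i<a. x i) \<le> (\<Sum>i<b. x i)" if "a \<le> b" for a b
    using that nonneg by (intro sum_mono2) auto
  have lower: "A (k j (e j m)) / \<alpha> j \<le> A m" if "0 < m" for j m
  proof -
    have k: "k j (e j m) \<le> m" "0 < k j (e j m)" "real m \<le> \<alpha> j * real (k j (e j m))"
    proof -
      show "k j (e j m) \<le> m"
        using e_bounds(1)[OF that, of j] unfolding k_def by linarith
      show "0 < k j (e j m)"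
        using one_le_power[of "\<alpha> j" "e j m"] \<alpha>[of j] unfolding k_def by linarith
      have "\<alpha> j ^ e j m \<le> real (k j (e j m))"
        unfolding k_def by linarith
      then have "\<alpha> j * \<alpha> j ^ e j m \<le> \<alpha> j * real (k j (e j m))"
        using \<alpha>[of j] by (intro mult_left_mono) auto
      with e_bounds(2)[OF that, of j] show "real m \<le> \<alpha> j * real (k j (e j m))" by simp
    qed
    have "A (k j (e j m)) / \<alpha> j = (\<Sum>i<k j (e j m). x i) / (\<alpha> j * real (k j (e j m)))"
      by (simp add: A_def)
    also have "\<dots> \<le> (\<Sum>i<m. x i) / real m"
      using k that mono[OF k(1)] nonneg by (intro frac_le) (auto intro: sum_nonneg)
    finally show ?thesis by (simp add: A_def)
  qed
  have upper: "A m \<le> A (k j (Suc (e j m))) * (\<alpha> j + inverse (real m) )" if "0 < m" for j m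
  proof -
    let ?k = "k j (Suc (e j m))"
    have k: "m \<le> ?k" "real ?k \<le> (\<alpha> j + inverse (real m)) * real m"
    proof -
      show "m \<le> ?k"
        using e_bounds(2)[OF that, of j] unfolding k_def by linarith
      have "0 \<le> \<alpha> j ^ Suc (e j m)"
        using \<alpha>[of j] by simp
      then have "real ?k \<le> \<alpha> j ^ Suc (e j m) + 1"
        unfolding k_def by linarith
      then have "real ?k \<le> \<alpha> j * \<alpha> j ^ e j m + 1" by simp
      also have "\<dots> \<le> \<alpha> j * real m + 1"
        using e_bounds(1)[OF that, of j] \<alpha>[of j] by simp
      also have "\<dots> = (\<alpha> j + inverse (real m)) * real m"
        using that by (simp add: distrib_right)
      finally show "real ?k \<le> (\<alpha> j + inverse (real m)) * real m" .
    qed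
    have kpos: "0 < ?k" using k(1) that by linarith
    have "A m \<le> (\<Sum>i<?k. x i) / real m"
      unfolding A_def using mono[OF k(1)] by (rule divide_right_mono) simp
    also have "\<dots> = A ?k * (real ?k / real m)"
      using kpos by (simp add: A_def)
    also have "\<dots> \<le> A ?k * (\<alpha> j + inverse (real m))"
      using k(2) that nonneg
      by (intro mult_left_mono) (auto simp: A_def divide_le_eq intro!: divide_nonneg_nonneg sum_nonneg)
    finally show ?thesis .
  qed
  have "A \<longlonglongrightarrow> \<mu>"
  proof (rule order_tendstoI)
    fix a assume "a < \<mu>"
    have "(\<lambda>j. \<mu> / \<alpha> j) \<longlonglongrightarrow> \<mu> / 1"
      by (intro tendsto_intros \<alpha>_lim) simp
    then have "eventually (\<lambda>j. a < \<mu> / \<alpha> j) sequentially"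
      using \<open>a < \<mu>\<close> by (intro order_tendstoD) auto
    then obtain j where j: "a < \<mu> / \<alpha> j"
      by (auto simp: eventually_sequentially)
    have "(\<lambda>m. A (k j (e j m)) / \<alpha> j) \<longlonglongrightarrow> \<mu> / \<alpha> j"
      using \<alpha>[of j] by (intro tendsto_divide tendsto_const filterlim_compose[OF A_lim e_lim]) auto
    then have "eventually (\<lambda>m. a < A (k j (e j m)) / \<alpha> j) sequentially"
      using j by (rule order_tendstoD)
    then show "eventually (\<lambda>m. a < A m) sequentially"
      using eventually_gt_at_top[of 0]
      by eventually_elim (rule less_le_trans[OF _ lower])
  next
    fix a assume "\<mu> < a"
    have "(\<lambda>j. \<mu> * \<alpha> j) \<longlonglongrightarrow> \<mu> * 1"
      by (intro tendsto_intros \<alpha>_lim)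
    then have "eventually (\<lambda>j. \<mu> * \<alpha> j < a) sequentially"
      using \<open>\<mu> < a\<close> by (intro order_tendstoD) auto
    then obtain j where j: "\<mu> * \<alpha> j < a"
      by (auto simp: eventually_sequentially)
    have "(\<lambda>m. A (k j (Suc (e j m))) * (\<alpha> j + inverse (real m))) \<longlonglongrightarrow> \<mu> * (\<alpha> j + 0)"
      by (intro tendsto_mult tendsto_add tendsto_const lim_inverse_n
          filterlim_compose[OF A_lim filterlim_compose[OF filterlim_Suc e_lim]])
    then have "eventually (\<lambda>m. A (k j (Suc (e j m))) * (\<alpha> j + inverse (real m)) < a) sequentially"
      using j by (intro order_tendstoD) auto
    then show "eventually (\<lambda>m. A m < a) sequentially"
      using eventually_gt_at_top[of 0]
      by eventually_elim (rule le_less_trans[OF upper])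
  qed
  then show ?thesis by (simp add: A_def[abs_def])
qed

theorem (in nonneg_pairwise_iid) averages_nonneg:
  "AE \<omega> in M. (\<lambda>m. (\<Sum>i<m. X i \<omega>) / real m) \<longlonglongrightarrow> expectation (X 0)"
proof -
  have "AE \<omega> in M. \<forall>j. (\<lambda>n. (\<Sum>i<nat \<lceil>(1 + inverse (real (Suc j))) ^ n\<rceil>. X i \<omega>) /
      real (nat \<lceil>(1 + inverse (real (Suc j))) ^ n\<rceil>)) \<longlonglongrightarrow> expectation (X 0)"
    unfolding AE_all_countable by (intro allI averages_along_powers) simp
  then show ?thesis
    by eventually_elim (rule averages_from_powers, use nonneg in auto)
qed

theorem (in pairwise_iid) strong_law:
  "AE \<omega> in M. (\<lambda>m. (\<Sum>i<m. X i \<omega>) / real m) \<longlonglongrightarrow> expectation (X 0)"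
proof -
  \<comment> \<open>\<open>c = 1\<close> gives the positive parts and \<open>c = -1\<close> the negative parts\<close>
  have part: "nonneg_pairwise_iid M (\<lambda>i \<omega>. max 0 (c * X i \<omega>))" for c
  proof
    show "integrable M (\<lambda>\<omega>. max 0 (c * X i \<omega>))" for i
      using integrable by (intro integrable_max) auto
    show "distr M borel (\<lambda>\<omega>. max 0 (c * X i \<omega>)) = distr M borel (\<lambda>\<omega>. max 0 (c * X 0 \<omega>))" for i
    proof -
      have "distr M borel (\<lambda>\<omega>. max 0 (c * X i \<omega>)) = distr (distr M borel (X i)) borel (\<lambda>x. max 0 (c * x))" for i
        by (simp add: distr_distr comp_def)
      then show ?thesis by (simp only: distr_eq[of i])
    qed
    show "indep_var borel (\<lambda>\<omega>. max 0 (c * X i \<omega>)) borel (\<lambda>\<omega>. max 0 (c * X j \<omega>))" if "i \<noteq> j" for i j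
      using indep_var_compose[OF pairwise_indep[OF that], of "\<lambda>x. max 0 (c * x)" borel "\<lambda>x. max 0 (c * x)" borel]
      by (simp add: comp_def)
  qed simp
  have "expectation (X 0) = expectation (\<lambda>\<omega>. max 0 (1 * X 0 \<omega>) - max 0 (-1 * X 0 \<omega>))"
    by (intro Bochner_Integration.integral_cong) auto
  also have "\<dots> = expectation (\<lambda>\<omega>. max 0 (1 * X 0 \<omega>)) - expectation (\<lambda>\<omega>. max 0 (-1 * X 0 \<omega>))"
    using integrable by (intro Bochner_Integration.integral_diff integrable_max) auto
  finally have mean: "expectation (X 0) = \<dots>" .
  show ?thesis
    using nonneg_pairwise_iid.averages_nonneg[OF part[of 1]] nonneg_pairwise_iid.averages_nonneg[OF part[of "-1"]]
  proof eventually_elim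
    fix \<omega>
    assume "(\<lambda>m. (\<Sum>i<m. max 0 (1 * X i \<omega>)) / real m) \<longlonglongrightarrow> expectation (\<lambda>\<omega>. max 0 (1 * X 0 \<omega>))"
      and "(\<lambda>m. (\<Sum>i<m. max 0 (-1 * X i \<omega>)) / real m) \<longlonglongrightarrow> expectation (\<lambda>\<omega>. max 0 (-1 * X 0 \<omega>))"
    note lim = tendsto_diff[OF this]
    have parts: "max 0 (1 * x) - max 0 (-1 * x) = x" for x :: real
      by auto
    show "(\<lambda>m. (\<Sum>i<m. X i \<omega>) / real m) \<longlonglongrightarrow> expectation (X 0)"
      using lim unfolding mean by (simp only: diff_divide_distrib[symmetric] sum_subtractf[symmetric] parts)
  qed
qed

section \<open>Regenerative sequences\<close>

lemma emeasure_distr_eq_nn_integral: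
  assumes "f \<in> M \<rightarrow>\<^sub>M N" "A \<in> sets N"
  shows "emeasure (distr M N f) A = (\<integral>\<^sup>+w. indicator A (f w) \<partial>M)"
proof -
  have "emeasure (distr M N f) A = (\<integral>\<^sup>+y. indicator A y \<partial>distr M N f)"
    using assms by simp
  also have "\<dots> = (\<integral>\<^sup>+w. indicator A (f w) \<partial>M)"
    using assms by (intro nn_integral_distr) simp_all
  finally show ?thesis .
qed

text \<open>
  \<open>Y\<close> describes the first cycle of a random system and \<open>R\<close> is the system as seen from the end of
  that cycle. The condition \<open>renewal\<close> says that \<open>(Y, R)\<close> has the product of the law of \<open>Y\<close> with the
  law \<open>M\<close> of the whole system; iterating \<open>R\<close> then produces a sequence of cycles to which the strong
  law applies.
\<close>

locale regenerative = prob_space M for M :: "'w measure" +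
  fixes N :: "'y measure" and Y :: "'w \<Rightarrow> 'y" and R :: "'w \<Rightarrow> 'w"
  assumes measurable_Y [measurable]: "Y \<in> M \<rightarrow>\<^sub>M N" and measurable_R [measurable]: "R \<in> M \<rightarrow>\<^sub>M M"
    and renewal: "\<And>F. F \<in> borel_measurable (N \<Otimes>\<^sub>M M) \<Longrightarrow>
      (\<integral>\<^sup>+w. F (Y w, R w) \<partial>M) = (\<integral>\<^sup>+w. \<integral>\<^sup>+v. F (Y w, v) \<partial>M \<partial>M)"
begin

lemma measurable_iterate [measurable]: "(\<lambda>w. (R ^^ i) w) \<in> M \<rightarrow>\<^sub>M M"
  by (induction i) simp_all

lemma nn_integral_iterate:
  "f \<in> borel_measurable M \<Longrightarrow> (\<integral>\<^sup>+w. f ((R ^^ i) w) \<partial>M) = (\<integral>\<^sup>+w. f w \<partial>M)"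
proof (induction i arbitrary: f)
  case (Suc i)
  note [measurable] = Suc.prems
  have "(\<integral>\<^sup>+w. f ((R ^^ Suc i) w) \<partial>M) = (\<integral>\<^sup>+w. f (R w) \<partial>M)"
    using Suc.IH[of "\<lambda>w. f (R w)"] by simp
  also have "\<dots> = (\<integral>\<^sup>+w. f w \<partial>M)"
    using renewal[of "\<lambda>p. f (snd p)"] by (simp add: emeasure_space_1)
  finally show ?case .
qed simp

lemma distr_iterate: "distr M M (R ^^ i) = M"
proof (rule measure_eqI)
  fix A assume "A \<in> sets (distr M M (R ^^ i))"
  then have [measurable]: "A \<in> sets M" by simp
  have "emeasure (distr M M (R ^^ i)) A = (\<integral>\<^sup>+w. indicator A ((R ^^ i) w) \<partial>M)"
    by (rule emeasure_distr_eq_nn_integral) simp_all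
  also have "\<dots> = (\<integral>\<^sup>+w. indicator A w \<partial>M)"
    by (rule nn_integral_iterate) simp
  finally show "emeasure (distr M M (R ^^ i)) A = emeasure M A" by simp
qed simp

lemma AE_iterate:
  assumes "AE w in M. P w" shows "AE w in M. P ((R ^^ i) w)"
proof -
  have "AE w in distr M M (R ^^ i). P w"
    unfolding distr_iterate by (rule assms)
  then show ?thesis by (intro AE_distrD[of "R ^^ i" M M P]) simp_all
qed

lemma distr_cycle: "distr M N (\<lambda>w. Y ((R ^^ i) w)) = distr M N Y"
proof -
  have "distr M N (\<lambda>w. Y ((R ^^ i) w)) = distr (distr M M (R ^^ i)) N Y"
    by (subst distr_distr) (simp_all add: comp_def)
  then show ?thesis by (simp add: distr_iterate)
qed

text \<open>
  By stationarity the earlier cycle can be taken to be the first one; the later cycle is then a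
  function of the restarted system, which is independent of the first cycle.
\<close>

lemma prob_cycles:
  assumes [measurable]: "A \<in> sets N" "B \<in> sets N" and "i < j"
  shows "(\<integral>\<^sup>+w. indicator A (Y ((R ^^ i) w)) * indicator B (Y ((R ^^ j) w)) \<partial>M) =
    emeasure (distr M N Y) A * emeasure (distr M N Y) B"
proof -
  obtain d where d: "j = Suc d + i"
    using \<open>i < j\<close> by (metis add.commute add_Suc_right less_imp_Suc_add)
  have "(\<integral>\<^sup>+w. indicator A (Y ((R ^^ i) w)) * indicator B (Y ((R ^^ j) w)) \<partial>M) =
      (\<integral>\<^sup>+w. indicator A (Y w) * indicator B (Y ((R ^^ Suc d) w)) \<partial>M)"
    using nn_integral_iterate[of "\<lambda>w. indicator A (Y w) * indicator B (Y ((R ^^ Suc d) w))" i]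
    unfolding d by (simp add: funpow_add)
  also have "\<dots> = (\<integral>\<^sup>+w. \<integral>\<^sup>+v. indicator A (Y w) * indicator B (Y ((R ^^ d) v)) \<partial>M \<partial>M)"
    using renewal[of "\<lambda>p. indicator A (fst p) * indicator B (Y ((R ^^ d) (snd p)))"]
    by (simp add: funpow_swap1)
  also have "\<dots> = (\<integral>\<^sup>+w. indicator A (Y w) \<partial>M) * (\<integral>\<^sup>+v. indicator B (Y ((R ^^ d) v)) \<partial>M)"
    by (simp add: nn_integral_cmult nn_integral_multc del: nn_integral_indicator)
  also have "(\<integral>\<^sup>+v. indicator B (Y ((R ^^ d) v)) \<partial>M) = (\<integral>\<^sup>+v. indicator B (Y v) \<partial>M)"
    by (rule nn_integral_iterate) measurable
  finally show ?thesis
    using assms by (simp only: emeasure_distr_eq_nn_integral[OF measurable_Y])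
qed

lemma indep_cycles:
  assumes "i \<noteq> j"
  shows "indep_var N (\<lambda>w. Y ((R ^^ i) w)) N (\<lambda>w. Y ((R ^^ j) w))"
proof (subst indep_var_distribution_eq, intro conjI, unfold distr_cycle[of i] distr_cycle[of j])
  show "distr M N Y \<Otimes>\<^sub>M distr M N Y = distr M (N \<Otimes>\<^sub>M N) (\<lambda>w. (Y ((R ^^ i) w), Y ((R ^^ j) w)))"
  proof (rule pair_measure_eqI)
    interpret D: prob_space "distr M N Y" by (rule prob_space_distr) simp
    show "sigma_finite_measure (distr M N Y)" "sigma_finite_measure (distr M N Y)"
      by (fact D.sigma_finite_measure_axioms)+
    fix A B assume "A \<in> sets (distr M N Y)" "B \<in> sets (distr M N Y)"
    then have [measurable]: "A \<in> sets N" "B \<in> sets N" by simp_all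
    have "emeasure (distr M (N \<Otimes>\<^sub>M N) (\<lambda>w. (Y ((R ^^ i) w), Y ((R ^^ j) w)))) (A \<times> B) =
        (\<integral>\<^sup>+w. indicator (A \<times> B) (Y ((R ^^ i) w), Y ((R ^^ j) w)) \<partial>M)"
      by (rule emeasure_distr_eq_nn_integral) simp_all
    also have "\<dots> = (\<integral>\<^sup>+w. indicator A (Y ((R ^^ i) w)) * indicator B (Y ((R ^^ j) w)) \<partial>M)"
      by (simp add: indicator_times del: nn_integral_indicator)
    also have "\<dots> = emeasure (distr M N Y) A * emeasure (distr M N Y) B"
      using prob_cycles[of A B i j] prob_cycles[of B A j i] \<open>i \<noteq> j\<close>
      by (cases "i < j") (simp_all add: mult.commute)
    finally show "emeasure (distr M N Y) A * emeasure (distr M N Y) B =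
        emeasure (distr M (N \<Otimes>\<^sub>M N) (\<lambda>w. (Y ((R ^^ i) w), Y ((R ^^ j) w)))) (A \<times> B)" by simp
  qed simp_all
qed measurable

lemma cycle_averages:
  assumes [measurable]: "h \<in> borel_measurable N" and "has_bochner_integral M (\<lambda>w. h (Y w)) \<mu>"
  shows "AE w in M. (\<lambda>m. (\<Sum>i<m. h (Y ((R ^^ i) w))) / real m) \<longlonglongrightarrow> (\<mu> :: real)"
proof -
  have distr: "distr M borel (\<lambda>w. h (Y ((R ^^ i) w))) = distr (distr M N Y) borel h" for i
  proof -
    have "distr M borel (\<lambda>w. h (Y ((R ^^ i) w))) = distr (distr M N (\<lambda>w. Y ((R ^^ i) w))) borel h"
      by (subst distr_distr) (simp_all add: comp_def)
    then show ?thesis by (simp add: distr_cycle)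
  qed
  interpret iid: pairwise_iid M "\<lambda>i w. h (Y ((R ^^ i) w))"
  proof
    show "integrable M (\<lambda>w. h (Y ((R ^^ i) w)))" for i
    proof -
      have "integrable (distr M M (R ^^ i)) (\<lambda>w. h (Y w))"
        using assms(2) by (simp add: distr_iterate has_bochner_integral_iff)
      then show ?thesis by (subst (asm) integrable_distr_eq) simp_all
    qed
    show "distr M borel (\<lambda>w. h (Y ((R ^^ i) w))) = distr M borel (\<lambda>w. h (Y ((R ^^ 0) w)))" for i
      unfolding distr ..
    show "indep_var borel (\<lambda>w. h (Y ((R ^^ i) w))) borel (\<lambda>w. h (Y ((R ^^ j) w)))" if "i \<noteq> j" for i j
      using indep_var_compose[OF indep_cycles[OF that], of h borel h borel] by (simp add: comp_def)
  qed
  have "expectation (\<lambda>w. h (Y ((R ^^ 0) w))) = \<mu>"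
    using assms(2) by (simp add: has_bochner_integral_iff)
  with iid.strong_law show ?thesis by simp
qed

end

section \<open>Marked Poisson processes\<close>

abbreviation exponential :: "real \<Rightarrow> real measure" where
  "exponential l \<equiv> density lborel (exponential_density l)"

text \<open>
  Absence of memory, in the form in which it is integrated: on the event that the variable exceeds
  \<open>g\<close>, the excess has the original law.
\<close>

lemma nn_integral_exponential_memoryless:
  assumes l: "0 < l" and g: "0 \<le> g" and h[measurable]: "h \<in> borel_measurable borel"
  shows "(\<integral>\<^sup>+x. indicator {g<..} x * h (x - g) \<partial>exponential l) =
    ennreal (exp (- l * g)) * (\<integral>\<^sup>+x. h x \<partial>exponential l)"
proof -
  have "(\<integral>\<^sup>+x. indicator {g<..} x * h (x - g) \<partial>exponential l) =
      (\<integral>\<^sup>+x. ennreal (exponential_density l x) * (indicator {g<..} x * h (x - g)) \<partial>lborel)"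
    by (simp add: nn_integral_density)
  also have "\<dots> = (\<integral>\<^sup>+x. ennreal (exponential_density l (g + 1 * x)) *
      (indicator {g<..} (g + 1 * x) * h (g + 1 * x - g)) \<partial>lborel)"
    by (subst nn_integral_real_affine[where c=1 and t=g]) simp_all
  also have "\<dots> = (\<integral>\<^sup>+x. ennreal (exp (- l * g)) * (ennreal (exponential_density l x) * h x) \<partial>lborel)"
  proof (rule nn_integral_cong_AE)
    show "AE x in lborel. ennreal (exponential_density l (g + 1 * x)) *
        (indicator {g<..} (g + 1 * x) * h (g + 1 * x - g)) =
        ennreal (exp (- l * g)) * (ennreal (exponential_density l x) * h x)"
      using AE_lborel_singleton[of 0]
    proof eventually_elim
      fix x :: real assume "x \<noteq> 0"
      show "ennreal (exponential_density l (g + 1 * x)) *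
        (indicator {g<..} (g + 1 * x) * h (g + 1 * x - g)) =
        ennreal (exp (- l * g)) * (ennreal (exponential_density l x) * h x)"
      proof (cases "x < 0")
        case True
        then show ?thesis by (simp add: exponential_density_def indicator_def)
      next
        case False
        with \<open>x \<noteq> 0\<close> have "x > 0" by simp
        have "l * exp (- (g + x) * l) = exp (- l * g) * (l * exp (- x * l))"
          by (simp add: exp_add[symmetric] algebra_simps)
        with \<open>x > 0\<close> g l show ?thesis
          by (simp add: exponential_density_def indicator_def ennreal_mult mult_ac)
      qed
    qed
  qed
  also have "\<dots> = ennreal (exp (- l * g)) * (\<integral>\<^sup>+x. h x \<partial>exponential l)"
    by (simp add: nn_integral_density nn_integral_cmult)
  finally show ?thesis .
qed

lemma exponential_nonneg: "0 < l \<Longrightarrow> AE g in exponential l. 0 \<le> g"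
  by (subst AE_density) (auto simp: exponential_density_def)

lemma exponential_pos: "0 < l \<Longrightarrow> AE g in exponential l. 0 < g"
  using AE_lborel_singleton[of 0]
  by (subst AE_density) (auto simp: exponential_density_def elim!: eventually_mono)

text \<open>
  A realisation of one class is the stream of its pairs (interarrival time, service time). Carrying
  the service time as a mark of the arrival lets both move together when time is advanced.
\<close>

definition marked_poisson :: "real \<Rightarrow> real measure \<Rightarrow> (real \<times> real) stream measure" where
  "marked_poisson l \<sigma> = stream_space (exponential l \<Otimes>\<^sub>M \<sigma>)"

abbreviation paths :: "(real \<times> real) stream measure" where
  "paths \<equiv> stream_space (borel \<Otimes>\<^sub>M borel)"

lemma space_paths [simp]: "space paths = UNIV"
  by (simp add: space_stream_space space_pair_measure)

lemma sets_Collect_paths: "Measurable.pred paths P \<Longrightarrow> {X. P X} \<in> sets paths"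
  by (simp add: pred_def)

definition arrival :: "(real \<times> real) stream \<Rightarrow> nat \<Rightarrow> real" where
  "arrival X j = (\<Sum>i\<le>j. fst (X !! i))"

text \<open>
  The path seen from time \<open>t\<close>: the points up to \<open>t\<close> are dropped, and the first later point keeps its
  mark but has only its residual interarrival time left. If no point lies beyond \<open>t\<close>, the value is
  meaningless; this has probability zero.
\<close>

definition advance :: "real \<Rightarrow> (real \<times> real) stream \<Rightarrow> (real \<times> real) stream" where
  "advance t X = (let J = LEAST j. t < arrival X j in
     (arrival X J - t, snd (X !! J)) ## sdrop (Suc J) X)"

lemma arrival_0 [simp]: "arrival X 0 = fst (shd X)"
  by (simp add: arrival_def)

lemma arrival_Suc: "arrival X (Suc j) = arrival X j + fst (X !! Suc j)"
  by (simp add: arrival_def)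

lemma arrival_SCons_Suc: "arrival (x ## X) (Suc j) = fst x + arrival X j"
  unfolding arrival_def by (subst sum.atMost_Suc_shift) simp

lemma arrival_reduce: "arrival ((g - c, s) ## X) j = arrival ((g, s) ## X) j - c"
  by (cases j) (simp_all add: arrival_SCons_Suc)

lemma advance_reduce: "advance t ((g - c, s) ## X) = advance (t + c) ((g, s) ## X)"
proof -
  have "((g - c, s) ## X) !! J = (if J = 0 then (g - c, s) else ((g, s) ## X) !! J)" for J
    by (cases J) auto
  then have "snd (((g - c, s) ## X) !! J) = snd (((g, s) ## X) !! J)" for J
    by simp
  then show ?thesis
    unfolding advance_def Let_def arrival_reduce less_diff_eq
    by (simp add: algebra_simps)
qed

lemma advance_before_first:
  assumes "t < g" shows "advance t ((g, s) ## X) = (g - t, s) ## X"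
proof -
  have "(LEAST j. t < arrival ((g, s) ## X) j) = 0"
    by (rule Least_eq_0) (simp add: assms)
  then show ?thesis by (simp add: advance_def)
qed

lemma advance_after_first:
  assumes "g \<le> t" and "\<exists>j. t < arrival ((g, s) ## X) j"
  shows "advance t ((g, s) ## X) = advance (t - g) X"
proof -
  from assms obtain j where "t < arrival ((g, s) ## X) j" by blast
  then have "(LEAST j. t < arrival ((g, s) ## X) j) =
      Suc (LEAST j. t < arrival ((g, s) ## X) (Suc j))"
    by (rule Least_Suc) (simp add: assms(1) not_less)
  also have "(\<lambda>j. t < arrival ((g, s) ## X) (Suc j)) = (\<lambda>j. t - g < arrival X j)"
    by (auto simp: arrival_SCons_Suc fun_eq_iff)
  finally show ?thesis
    by (simp add: advance_def Let_def arrival_SCons_Suc)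
qed

lemma advance_snth:
  assumes "\<exists>j. t < arrival X j"
  defines "J \<equiv> LEAST j. t < arrival X j"
  shows "arrival (advance t X) j = arrival X (J + j) - t"
    and "snd (advance t X !! j) = snd (X !! (J + j))"
proof -
  have adv: "advance t X = (arrival X J - t, snd (X !! J)) ## sdrop (Suc J) X"
    by (simp add: advance_def J_def Let_def)
  show "arrival (advance t X) j = arrival X (J + j) - t"
  proof (induction j)
    case 0
    show ?case by (simp add: adv)
  next
    case (Suc j)
    have "advance t X !! Suc j = X !! Suc (J + j)"
      unfolding adv by (simp add: sdrop_snth del: sdrop.simps)
    with Suc show ?case by (simp add: arrival_Suc)
  qed
  show "snd (advance t X !! j) = snd (X !! (J + j))"
    unfolding adv by (cases j) (simp_all add: sdrop_snth del: sdrop.simps)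
qed

lemma measurable_arrival [measurable]: "(\<lambda>X. arrival X j) \<in> borel_measurable paths"
  unfolding arrival_def by measurable

lemma measurable_advance [measurable]:
  "(\<lambda>(t, X). advance t X) \<in> borel \<Otimes>\<^sub>M paths \<rightarrow>\<^sub>M paths"
proof -
  have "(\<lambda>p. (\<lambda>J p. (arrival (snd p) J - fst p, snd (snd p !! J)) ## sdrop (Suc J) (snd p))
      (LEAST j. fst p < arrival (snd p) j) p) \<in> borel \<Otimes>\<^sub>M paths \<rightarrow>\<^sub>M paths"
    by (rule measurable_compose_countable) measurable
  then show ?thesis
    by (simp add: advance_def Let_def case_prod_beta')
qed

locale poisson_marks =
  fixes l :: real and \<sigma> :: "real measure"
  assumes rate_pos: "0 < l" and prob_mark: "prob_space \<sigma>"
    and sets_mark [measurable_cong, simp]: "sets \<sigma> = sets borel"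
begin

sublocale E: prob_space "exponential l"
  by (rule prob_space_exponential_density) (fact rate_pos)

sublocale mark: prob_space \<sigma>
  by (fact prob_mark)

sublocale point: pair_prob_space "exponential l" \<sigma> ..

sublocale prob_space "marked_poisson l \<sigma>"
  unfolding marked_poisson_def by (rule point.prob_space_stream_space)

lemma sets_marked_poisson [measurable_cong, simp]: "sets (marked_poisson l \<sigma>) = sets paths"
  unfolding marked_poisson_def
  by (intro sets_stream_space_cong sets_pair_measure_cong) simp_all

lemma space_marked_poisson [simp]: "space (marked_poisson l \<sigma>) = UNIV"
  using sets_eq_imp_space_eq[OF sets_marked_poisson]
  by (simp add: space_stream_space space_pair_measure)

lemma emeasure_marked_poisson_UNIV [simp]: "emeasure (marked_poisson l \<sigma>) UNIV = 1"
  using emeasure_space_1 by simp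

lemma nn_integral_marked_poisson:
  assumes [measurable]: "f \<in> borel_measurable paths"
  shows "(\<integral>\<^sup>+X. f X \<partial>marked_poisson l \<sigma>) =
    (\<integral>\<^sup>+g. \<integral>\<^sup>+s. \<integral>\<^sup>+X. f ((g, s) ## X) \<partial>marked_poisson l \<sigma> \<partial>\<sigma> \<partial>exponential l)"
proof -
  have "(\<integral>\<^sup>+X. f X \<partial>marked_poisson l \<sigma>) =
      (\<integral>\<^sup>+x. \<integral>\<^sup>+X. f (x ## X) \<partial>marked_poisson l \<sigma> \<partial>(exponential l \<Otimes>\<^sub>M \<sigma>))"
    unfolding marked_poisson_def
    by (rule point.nn_integral_stream_space)
      (simp add: measurable_cong_sets[OF sets_marked_poisson[unfolded marked_poisson_def] refl])
  also have "\<dots> = (\<integral>\<^sup>+g. \<integral>\<^sup>+s. \<integral>\<^sup>+X. f ((g, s) ## X) \<partial>marked_poisson l \<sigma> \<partial>\<sigma> \<partial>exponential l)"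
    by (subst mark.nn_integral_fst[symmetric]) simp_all
  finally show ?thesis .
qed

text \<open>
  Let \<open>q t\<close> be the probability that no point lies beyond \<open>t\<close>. Conditioning on the first gap \<open>g\<close>
  gives \<open>q t \<le> P (g \<le> t) * q t\<close>, since \<open>q\<close> is monotone, and \<open>P (g \<le> t) < 1\<close> forces \<open>q t = 0\<close>.
\<close>

lemma AE_arrival_beyond: "AE X in marked_poisson l \<sigma>. \<exists>j. t < arrival X j"
proof -
  \<comment> \<open>the probability \<open>q t\<close> as an integral, so that \<open>nn_integral_marked_poisson\<close> applies to it\<close>
  define q where "q t = (\<integral>\<^sup>+X. indicator {X. \<forall>j. arrival X j \<le> t} X \<partial>marked_poisson l \<sigma>)" for t
  have [measurable]: "{X. \<forall>j. arrival X j \<le> t} \<in> sets paths" for t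
    by (rule sets_Collect_paths) measurable
  have mono: "q t \<le> q t'" if "t \<le> t'" for t t'
    unfolding q_def using that
    by (intro nn_integral_mono) (auto simp: indicator_def intro: order_trans)
  have rec: "q t \<le> emeasure (exponential l) {..t} * q t" for t
  proof -
    have "q t = (\<integral>\<^sup>+g. \<integral>\<^sup>+s. \<integral>\<^sup>+X. indicator {X. \<forall>j. arrival X j \<le> t} ((g, s) ## X)
        \<partial>marked_poisson l \<sigma> \<partial>\<sigma> \<partial>exponential l)"
      unfolding q_def by (rule nn_integral_marked_poisson) simp
    also have "\<dots> = (\<integral>\<^sup>+g. \<integral>\<^sup>+s. indicator {..t} g * q (t - g) \<partial>\<sigma> \<partial>exponential l)"
    proof (intro nn_integral_cong)
      fix g s :: real
      have "(\<forall>j. arrival ((g, s) ## X) j \<le> t) \<longleftrightarrow> g \<le> t \<and> (\<forall>j. arrival X j \<le> t - g)" for X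
      proof -
        have "(\<forall>j. arrival ((g, s) ## X) j \<le> t) \<longleftrightarrow> g \<le> t \<and> (\<forall>j. arrival ((g, s) ## X) (Suc j) \<le> t)"
          by (metis arrival_0 fst_conv not0_implies_Suc stream.sel(1))
        then show ?thesis by (simp add: arrival_SCons_Suc algebra_simps)
      qed
      then have "indicator {X. \<forall>j. arrival X j \<le> t} ((g, s) ## X) =
          (indicator {..t} g * indicator {X. \<forall>j. arrival X j \<le> t - g} X :: ennreal)" for X
        by (simp add: indicator_def)
      then show "(\<integral>\<^sup>+X. indicator {X. \<forall>j. arrival X j \<le> t} ((g, s) ## X) \<partial>marked_poisson l \<sigma>) =
          indicator {..t} g * q (t - g)"
        unfolding q_def by (simp add: nn_integral_cmult del: nn_integral_indicator)
    qed
    also have "\<dots> = (\<integral>\<^sup>+g. indicator {..t} g * q (t - g) \<partial>exponential l)"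
      by (simp add: mark.emeasure_space_1)
    also have "\<dots> \<le> (\<integral>\<^sup>+g. indicator {..t} g * q t \<partial>exponential l)"
    proof (rule nn_integral_mono_AE)
      show "AE g in exponential l. indicator {..t} g * q (t - g) \<le> indicator {..t} g * q t"
        using exponential_nonneg[OF rate_pos]
        by eventually_elim (auto intro!: mult_left_mono mono)
    qed
    also have "\<dots> = emeasure (exponential l) {..t} * q t"
      by (simp add: nn_integral_multc)
    finally show ?thesis .
  qed
  have "q t = 0"
  proof (rule ccontr)
    assume "q t \<noteq> 0"
    have "q t \<le> (\<integral>\<^sup>+X. 1 \<partial>marked_poisson l \<sigma>)"
      unfolding q_def by (intro nn_integral_mono) (auto simp: indicator_def)
    then have fin: "q t \<noteq> top"
      by (auto simp: emeasure_space_1 top_unique)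
    have lt: "emeasure (exponential l) {..t} < 1"
    proof -
      have 1: "emeasure (exponential l) {t'<..} > 0" if "t' \<ge> 0" for t'
      proof -
        have "(\<integral>\<^sup>+x. indicator {t'<..} x * 1 \<partial>exponential l) = ennreal (exp (- l * t')) * (\<integral>\<^sup>+x. 1 \<partial>exponential l)"
          by (rule nn_integral_exponential_memoryless) (use that rate_pos in auto)
        then show ?thesis
          using E.emeasure_space_1 by simp
      qed
      have "emeasure (exponential l) {t<..} > 0"
        using 1[of "max t 0"] by (rule less_le_trans) (auto intro!: emeasure_mono)
      then have "E.prob {t<..} > 0"
        by (simp add: E.emeasure_eq_measure)
      moreover have "E.prob {t<..} = 1 - E.prob {..t}"
        using E.prob_compl[of "{..t}"] by (simp add: Compl_eq_Diff_UNIV[symmetric] not_le[symmetric] Compl_atMost)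
      ultimately show ?thesis by (simp add: E.emeasure_eq_measure)
    qed
    have "emeasure (exponential l) {..t} * q t < 1 * q t"
      using lt \<open>q t \<noteq> 0\<close> fin by (intro ennreal_mult_strict_right_mono) (auto simp: top.not_eq_extremum zero_less_iff_neq_zero)
    with rec[of t] show False by (simp add: not_less[symmetric])
  qed
  then have "AE X in marked_poisson l \<sigma>. indicator {X. \<forall>j. arrival X j \<le> t} X = (0::ennreal)"
    unfolding q_def by (subst (asm) nn_integral_0_iff_AE) simp_all
  then show ?thesis
    by eventually_elim (auto simp: indicator_def not_le split: if_splits)
qed

text \<open>
  On the event that at most \<open>m\<close> points precede time \<open>t\<close>. The induction on \<open>m\<close> conditions on
  the first gap: if it exceeds \<open>t\<close>, the residual path is fresh by absence of memory; otherwise the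
  claim for \<open>m - 1\<close> points applies to the remaining path and the remaining time. Both sides satisfy
  the resulting recursion.
\<close>

lemma nn_integral_advance_within:
  assumes "0 \<le> t" and f[measurable]: "f \<in> borel_measurable paths"
  shows "(\<integral>\<^sup>+X. indicator {X. \<exists>j\<le>m. t < arrival X j} X * f (advance t X) \<partial>marked_poisson l \<sigma>) =
    emeasure (marked_poisson l \<sigma>) {X. \<exists>j\<le>m. t < arrival X j} * (\<integral>\<^sup>+X. f X \<partial>marked_poisson l \<sigma>)"
proof -
  let ?P = "marked_poisson l \<sigma>"
  have [measurable]: "{X. \<exists>j\<le>m. t < arrival X j} \<in> sets paths" for m t
    by (rule sets_Collect_paths) measurable
  \<comment> \<open>the general integrand \<open>h\<close> allows the recursion to be used for \<open>f\<close> and for the constant 1\<close>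
  define V where "V h m t = (\<integral>\<^sup>+X. indicator {X. \<exists>j\<le>m. t < arrival X j} X * h (advance t X) \<partial>?P)"
    for h :: "(real \<times> real) stream \<Rightarrow> ennreal" and m :: nat and t
  have V_first: "(\<integral>\<^sup>+g. \<integral>\<^sup>+s. \<integral>\<^sup>+X. indicator {t<..} g * h ((g - t, s) ## X) \<partial>?P \<partial>\<sigma> \<partial>exponential l) =
      ennreal (exp (- l * t)) * (\<integral>\<^sup>+X. h X \<partial>?P)"
    if "0 \<le> t" and [measurable]: "h \<in> borel_measurable paths" for h t
  proof -
    have "(\<integral>\<^sup>+g. \<integral>\<^sup>+s. \<integral>\<^sup>+X. indicator {t<..} g * h ((g - t, s) ## X) \<partial>?P \<partial>\<sigma> \<partial>exponential l) =
        (\<integral>\<^sup>+g. indicator {t<..} g * (\<integral>\<^sup>+s. \<integral>\<^sup>+X. h ((g - t, s) ## X) \<partial>?P \<partial>\<sigma>) \<partial>exponential l)"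
      by (simp add: nn_integral_cmult)
    also have "\<dots> = ennreal (exp (- l * t)) *
        (\<integral>\<^sup>+g. \<integral>\<^sup>+s. \<integral>\<^sup>+X. h ((g, s) ## X) \<partial>?P \<partial>\<sigma> \<partial>exponential l)"
      using that rate_pos by (intro nn_integral_exponential_memoryless) simp_all
    finally show ?thesis
      unfolding nn_integral_marked_poisson[OF that(2)] .
  qed
  have V_0: "V h 0 t = ennreal (exp (- l * t)) * (\<integral>\<^sup>+X. h X \<partial>?P)"
    if "0 \<le> t" and [measurable]: "h \<in> borel_measurable paths" for h t
  proof -
    have "V h 0 t = (\<integral>\<^sup>+g. \<integral>\<^sup>+s. \<integral>\<^sup>+X. indicator {t<..} g * h ((g - t, s) ## X) \<partial>?P \<partial>\<sigma> \<partial>exponential l)"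
      unfolding V_def
      by (subst nn_integral_marked_poisson, measurable)
        (auto intro!: nn_integral_cong simp: indicator_def advance_before_first)
    then show ?thesis using V_first[OF that] by simp
  qed
  have V_Suc: "V h (Suc m) t = ennreal (exp (- l * t)) * (\<integral>\<^sup>+X. h X \<partial>?P) +
      (\<integral>\<^sup>+g. indicator {..t} g * V h m (t - g) \<partial>exponential l)"
    if "0 \<le> t" and [measurable]: "h \<in> borel_measurable paths" for h m t
  proof -
    have "V h (Suc m) t = (\<integral>\<^sup>+g. \<integral>\<^sup>+s. \<integral>\<^sup>+X. indicator {t<..} g * h ((g - t, s) ## X) +
        indicator {..t} g * (indicator {X. \<exists>j\<le>m. t - g < arrival X j} X * h (advance (t - g) X))
        \<partial>?P \<partial>\<sigma> \<partial>exponential l)"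
      unfolding V_def
    proof (subst nn_integral_marked_poisson, measurable, intro nn_integral_cong)
      fix g s :: real and X
      have iff: "(\<exists>j\<le>Suc m. t < arrival ((g, s) ## X) j) \<longleftrightarrow> t < g \<or> (\<exists>j\<le>m. t - g < arrival X j)"
      proof -
        have "(\<exists>j\<le>Suc m. t < arrival ((g, s) ## X) j) \<longleftrightarrow> t < g \<or> (\<exists>j\<le>m. t < arrival ((g, s) ## X) (Suc j))"
          by (metis (no_types, lifting) Suc_le_mono arrival_0 fst_conv le0 not0_implies_Suc stream.sel(1))
        then show ?thesis by (simp add: arrival_SCons_Suc algebra_simps)
      qed
      show "indicator {X. \<exists>j\<le>Suc m. t < arrival X j} ((g, s) ## X) * h (advance t ((g, s) ## X)) =
        indicator {t<..} g * h ((g - t, s) ## X) +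
        indicator {..t} g * (indicator {X. \<exists>j\<le>m. t - g < arrival X j} X * h (advance (t - g) X))"
      proof (cases "t < g")
        case True
        then show ?thesis by (auto simp: iff advance_before_first)
      next
        case False
        then show ?thesis
          using iff advance_after_first[of g t s X]
          by (cases "\<exists>j\<le>m. t - g < arrival X j"; simp add: indicator_def; metis)
      qed
    qed
    also have "\<dots> = (\<integral>\<^sup>+g. \<integral>\<^sup>+s. \<integral>\<^sup>+X. indicator {t<..} g * h ((g - t, s) ## X) \<partial>?P \<partial>\<sigma> \<partial>exponential l) +
        (\<integral>\<^sup>+g. \<integral>\<^sup>+s. \<integral>\<^sup>+X. indicator {..t} g *
          (indicator {X. \<exists>j\<le>m. t - g < arrival X j} X * h (advance (t - g) X)) \<partial>?P \<partial>\<sigma> \<partial>exponential l)"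
      by (simp add: nn_integral_add)
    also have "(\<integral>\<^sup>+g. \<integral>\<^sup>+s. \<integral>\<^sup>+X. indicator {..t} g *
          (indicator {X. \<exists>j\<le>m. t - g < arrival X j} X * h (advance (t - g) X)) \<partial>?P \<partial>\<sigma> \<partial>exponential l) =
        (\<integral>\<^sup>+g. indicator {..t} g * V h m (t - g) \<partial>exponential l)"
      by (simp add: nn_integral_cmult V_def mark.emeasure_space_1)
    finally show ?thesis using V_first[OF that] by simp
  qed
  have V_meas[measurable]: "(\<lambda>t. V h m t) \<in> borel_measurable borel"
    if [measurable]: "h \<in> borel_measurable paths" for h m
    unfolding V_def by measurable
  have "V f m t = V (\<lambda>_. 1) m t * (\<integral>\<^sup>+X. f X \<partial>?P)"
    using \<open>0 \<le> t\<close>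
  proof (induction m arbitrary: t)
    case 0
    then show ?case by (simp add: V_0 emeasure_space_1)
  next
    case (Suc m)
    have "(\<integral>\<^sup>+g. indicator {..t} g * V f m (t - g) \<partial>exponential l) =
        (\<integral>\<^sup>+g. indicator {..t} g * V (\<lambda>_. 1) m (t - g) * (\<integral>\<^sup>+X. f X \<partial>?P) \<partial>exponential l)"
      by (intro nn_integral_cong) (auto simp: indicator_def Suc.IH)
    then show ?case
      using Suc.prems by (simp add: V_Suc emeasure_space_1 nn_integral_multc distrib_right)
  qed
  then show ?thesis by (simp add: V_def)
qed

text \<open>
  Stationarity of the marked process under deterministic time shifts. Since almost surely only
  finitely many points precede \<open>t\<close>, it is the limit \<open>m \<longlongrightarrow> \<infinity>\<close> of \<open>nn_integral_advance_within\<close>.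
\<close>

lemma nn_integral_advance:
  assumes "0 \<le> t" and f[measurable]: "f \<in> borel_measurable paths"
  shows "(\<integral>\<^sup>+X. f (advance t X) \<partial>marked_poisson l \<sigma>) = (\<integral>\<^sup>+X. f X \<partial>marked_poisson l \<sigma>)"
proof -
  let ?P = "marked_poisson l \<sigma>" and ?B = "\<lambda>m. {X. \<exists>j\<le>m. t < arrival X j}"
  have [measurable]: "?B m \<in> sets paths" for m
    by (rule sets_Collect_paths) measurable
  have UN: "(\<integral>\<^sup>+X. h (advance t X) \<partial>?P) = (SUP m. \<integral>\<^sup>+X. indicator (?B m) X * h (advance t X) \<partial>?P)"
    if [measurable]: "h \<in> borel_measurable paths" for h
  proof -
    have "(\<integral>\<^sup>+X. h (advance t X) \<partial>?P) = (\<integral>\<^sup>+X. (SUP m. indicator (?B m) X * h (advance t X)) \<partial>?P)"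
    proof (rule nn_integral_cong_AE)
      show "AE X in ?P. h (advance t X) = (SUP m. indicator (?B m) X * h (advance t X))"
        using AE_arrival_beyond[of t]
      proof eventually_elim
        fix X assume "\<exists>j. t < arrival X j"
        then obtain j where "t < arrival X j" ..
        then have "indicator (?B j) X * h (advance t X) = h (advance t X)"
          by (auto simp: indicator_def)
        then have "h (advance t X) \<le> (SUP m. indicator (?B m) X * h (advance t X))"
          by (intro SUP_upper2[of j]) simp_all
        moreover have "(SUP m. indicator (?B m) X * h (advance t X)) \<le> h (advance t X)"
          by (intro SUP_least) (auto simp: indicator_def)
        ultimately show "h (advance t X) = (SUP m. indicator (?B m) X * h (advance t X))"
          by (rule antisym)
      qed
    qed
    also have "\<dots> = (SUP m. \<integral>\<^sup>+X. indicator (?B m) X * h (advance t X) \<partial>?P)"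
      by (rule nn_integral_monotone_convergence_SUP)
        (auto simp: incseq_def le_fun_def indicator_def intro: order_trans)
    finally show ?thesis .
  qed
  have "(\<integral>\<^sup>+X. f (advance t X) \<partial>?P) = (SUP m. emeasure ?P (?B m) * (\<integral>\<^sup>+X. f X \<partial>?P))"
    by (simp add: UN nn_integral_advance_within assms)
  also have "\<dots> = (SUP m. emeasure ?P (?B m)) * (\<integral>\<^sup>+X. f X \<partial>?P)"
    by (rule SUP_mult_right_ennreal[symmetric]) 
  also have "(SUP m. emeasure ?P (?B m)) = 1"
    using UN[of "\<lambda>_. 1"] emeasure_space_1 by simp
  finally show ?thesis by simp
qed

text \<open>
  This governs a class that loses the race for an idle server: it has no arrival during the idle
  time \<open>g\<close>, and it is next looked at when the service of length \<open>s\<close> is over.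
\<close>

lemma nn_integral_advance_past:
  assumes "0 \<le> g" "0 \<le> s" and f[measurable]: "f \<in> borel_measurable paths"
  shows "(\<integral>\<^sup>+X. indicator {X. g < fst (shd X)} X * f (advance (g + s) X) \<partial>marked_poisson l \<sigma>) =
    ennreal (exp (- l * g)) * (\<integral>\<^sup>+X. f X \<partial>marked_poisson l \<sigma>)"
proof -
  let ?P = "marked_poisson l \<sigma>"
  have [measurable]: "{X. g < fst (shd X)} \<in> sets paths"
    by (rule sets_Collect_paths) measurable
  have "(\<integral>\<^sup>+X. indicator {X. g < fst (shd X)} X * f (advance (g + s) X) \<partial>?P) =
      (\<integral>\<^sup>+x. indicator {g<..} x * (\<integral>\<^sup>+r. \<integral>\<^sup>+X. f (advance s ((x - g, r) ## X)) \<partial>?P \<partial>\<sigma>) \<partial>exponential l)"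
    by (subst nn_integral_marked_poisson, measurable)
      (auto intro!: nn_integral_cong simp: advance_reduce add.commute[of s] indicator_def)
  also have "\<dots> = ennreal (exp (- l * g)) *
      (\<integral>\<^sup>+x. \<integral>\<^sup>+r. \<integral>\<^sup>+X. f (advance s ((x, r) ## X)) \<partial>?P \<partial>\<sigma> \<partial>exponential l)"
    using assms rate_pos by (intro nn_integral_exponential_memoryless) simp_all
  also have "\<dots> = ennreal (exp (- l * g)) * (\<integral>\<^sup>+X. f (advance s X) \<partial>?P)"
    by (subst nn_integral_marked_poisson[of "\<lambda>X. f (advance s X)"]) simp_all
  finally show ?thesis
    using assms by (simp add: nn_integral_advance)
qed

lemma AE_points:
  assumes [measurable]: "Measurable.pred (borel \<Otimes>\<^sub>M borel) Q"
    and AE: "AE g in exponential l. AE s in \<sigma>. Q (g, s)"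
  shows "AE X in marked_poisson l \<sigma>. \<forall>j. Q (X !! j)"
proof -
  have sets_eq: "sets (exponential l \<Otimes>\<^sub>M \<sigma>) = sets (borel \<Otimes>\<^sub>M borel)"
    by (intro sets_pair_measure_cong) simp_all
  have [measurable]: "Measurable.pred (exponential l \<Otimes>\<^sub>M \<sigma>) Q"
    using assms(1) by (simp add: measurable_cong_sets[OF sets_eq refl])
  have "AE x in exponential l \<Otimes>\<^sub>M \<sigma>. Q x"
    using AE by (intro point.AE_pair_measure) measurable
  then have "AE X in marked_poisson l \<sigma>. stream_all Q X"
    unfolding marked_poisson_def by (intro point.AE_stream_all) measurable
  then show ?thesis unfolding stream_all_def .
qed

end

section \<open>Competing Poisson processes and their restarts\<close>

text \<open>
  Rates and mark distributions are given for all indices, so that the path laws form a total family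
  of probability spaces; the classes of the queue are those in \<open>I\<close>.
\<close>

locale poisson_classes =
  fixes I :: "nat set" and l :: "nat \<Rightarrow> real" and \<sigma> :: "nat \<Rightarrow> real measure"
  assumes finite_classes: "finite I" and nonempty_classes: "I \<noteq> {}"
    and poisson_marks: "\<And>k. poisson_marks (l k) (\<sigma> k)"
    and mark_nonneg: "\<And>k. k \<in> I \<Longrightarrow> AE s in \<sigma> k. 0 \<le> s"
begin

sublocale cl: poisson_marks "l k" "\<sigma> k" for k
  by (fact poisson_marks)

sublocale P: product_prob_space "\<lambda>k. marked_poisson (l k) (\<sigma> k)" I ..

definition superposed :: "(nat \<Rightarrow> (real \<times> real) stream) measure" where
  "superposed = (\<Pi>\<^sub>M k\<in>I. marked_poisson (l k) (\<sigma> k))"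

abbreviation world :: "(nat \<Rightarrow> (real \<times> real) stream) measure" where
  "world \<equiv> (\<Pi>\<^sub>M k\<in>I. paths)"

lemma sets_superposed [measurable_cong, simp]: "sets superposed = sets world"
  unfolding superposed_def by (intro sets_PiM_cong) simp_all

lemma sets_PiM_marked_poisson [measurable_cong, simp]:
  "sets (\<Pi>\<^sub>M k\<in>J. marked_poisson (l k) (\<sigma> k)) = sets (\<Pi>\<^sub>M k\<in>J. paths)"
  by (intro sets_PiM_cong) simp_all

sublocale S: prob_space superposed
  unfolding superposed_def by (intro prob_space_PiM cl.prob_space_axioms)

definition total_rate :: real where "total_rate = (\<Sum>k\<in>I. l k)"

definition advance_all :: "real \<Rightarrow> (nat \<Rightarrow> (real \<times> real) stream) \<Rightarrow> nat \<Rightarrow> (real \<times> real) stream"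
  where "advance_all t w = (\<lambda>k\<in>I. advance t (w k))"

text \<open>
  The strict inequality makes the leading class unique. Ties need no separate exclusion: the
  probabilities that the individual classes lead strictly add up to one.
\<close>

definition leads :: "nat \<Rightarrow> (nat \<Rightarrow> (real \<times> real) stream) \<Rightarrow> bool" where
  "leads k w \<longleftrightarrow> (\<forall>j\<in>I - {k}. fst (shd (w k)) < fst (shd (w j)))"

definition leader :: "(nat \<Rightarrow> (real \<times> real) stream) \<Rightarrow> nat" where
  "leader w = (LEAST k. k \<in> I \<and> leads k w)"

definition head :: "(nat \<Rightarrow> (real \<times> real) stream) \<Rightarrow> nat \<times> real \<times> real" where
  "head w = (leader w, shd (w (leader w)))"

text \<open>
  All classes are advanced to the departure of the packet that arrives first.
\<close>

definition restart :: "(nat \<Rightarrow> (real \<times> real) stream) \<Rightarrow> nat \<Rightarrow> (real \<times> real) stream" where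
  "restart w = (case head w of (k, g, s) \<Rightarrow> advance_all (g + s) w)"

lemma leads_unique: "leads k w \<Longrightarrow> leads j w \<Longrightarrow> k \<in> I \<Longrightarrow> j \<in> I \<Longrightarrow> j = k"
  unfolding leads_def by (metis Diff_iff less_asym singletonD)

lemma leader_eq: "leads k w \<Longrightarrow> k \<in> I \<Longrightarrow> leader w = k"
  unfolding leader_def by (rule Least_equality) (auto dest: leads_unique)

lemma measurable_class_path:
  "(\<lambda>w. w k) \<in> (\<Pi>\<^sub>M k\<in>J. paths) \<rightarrow>\<^sub>M paths"
proof (cases "k \<in> J")
  case False
  have "(\<lambda>w. undefined) \<in> (\<Pi>\<^sub>M k\<in>J. paths) \<rightarrow>\<^sub>M paths"
    by (rule measurable_const) (simp add: space_stream_space space_pair_measure)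
  then show ?thesis
    using False by (subst measurable_cong) (auto simp: space_PiM PiE_def extensional_def)
qed simp

lemma measurable_advance_class [measurable (raw)]:
  assumes "f \<in> M \<rightarrow>\<^sub>M borel" "h \<in> M \<rightarrow>\<^sub>M paths"
  shows "(\<lambda>x. advance (f x) (h x)) \<in> M \<rightarrow>\<^sub>M paths"
  using measurable_compose[OF measurable_Pair[OF assms] measurable_advance] by simp

lemma measurable_leads [measurable]: "Measurable.pred world (leads k)"
proof -
  note measurable_class_path[measurable]
  show ?thesis
    unfolding leads_def using finite_classes by measurable
qed

lemma measurable_leader [measurable]: "leader \<in> world \<rightarrow>\<^sub>M count_space UNIV"
  unfolding leader_def by measurable

lemma measurable_head [measurable]: "head \<in> world \<rightarrow>\<^sub>M count_space UNIV \<Otimes>\<^sub>M (borel \<Otimes>\<^sub>M borel)"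
proof -
  note measurable_class_path[measurable]
  have "(\<lambda>w. (\<lambda>k w. shd (w k)) (leader w) w) \<in> world \<rightarrow>\<^sub>M borel \<Otimes>\<^sub>M borel"
    by (rule measurable_compose_countable) measurable
  then show ?thesis unfolding head_def by measurable
qed

lemma measurable_advance_all [measurable (raw)]:
  assumes [measurable]: "f \<in> M \<rightarrow>\<^sub>M borel" "h \<in> M \<rightarrow>\<^sub>M world"
  shows "(\<lambda>x. advance_all (f x) (h x)) \<in> M \<rightarrow>\<^sub>M world"
proof -
  have [measurable]: "(\<lambda>x. h x k) \<in> M \<rightarrow>\<^sub>M paths" for k
    using measurable_compose[OF assms(2) measurable_class_path] .
  show ?thesis
    unfolding advance_all_def by (rule measurable_restrict) measurable
qed

lemma measurable_restart [measurable]: "restart \<in> world \<rightarrow>\<^sub>M world"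
  unfolding restart_def case_prod_beta' by measurable

text \<open>
  All losing classes at once: the survival probabilities multiply, and jointly the residual paths
  have the original product law.
\<close>

lemma nn_integral_advance_past_all:
  assumes "finite J" "0 \<le> g" "0 \<le> s" and "F \<in> borel_measurable (\<Pi>\<^sub>M j\<in>J. paths)"
  shows "(\<integral>\<^sup>+w. indicator {w. \<forall>j\<in>J. g < fst (shd (w j))} w * F (\<lambda>j\<in>J. advance (g + s) (w j))
      \<partial>(\<Pi>\<^sub>M j\<in>J. marked_poisson (l j) (\<sigma> j))) =
    ennreal (exp (- (\<Sum>j\<in>J. l j) * g)) * (\<integral>\<^sup>+w. F w \<partial>(\<Pi>\<^sub>M j\<in>J. marked_poisson (l j) (\<sigma> j)))"
  using assms(1,4)
proof (induction J arbitrary: F)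
  case empty
  then show ?case by (simp add: PiM_empty nn_integral_count_space_finite)
next
  case (insert i J)
  note [measurable] = insert.prems
  let ?P = "\<lambda>J. \<Pi>\<^sub>M j\<in>J. marked_poisson (l j) (\<sigma> j)"
  have upd: "(\<lambda>(y, x). F (x(i := y))) \<in> borel_measurable (paths \<Otimes>\<^sub>M ?P J)"
    unfolding case_prod_beta'
    by (intro measurable_compose[OF measurable_fun_upd insert.prems]) auto
  interpret J: prob_space "?P J"
    by (intro prob_space_PiM cl.prob_space_axioms)
  define G where "G y = (\<integral>\<^sup>+x. F (x(i := y)) \<partial>?P J)" for y
  have [measurable]: "G \<in> borel_measurable paths"
    unfolding G_def using upd by (rule J.borel_measurable_nn_integral)
  have [measurable]: "(\<lambda>w. \<lambda>j\<in>insert i J. advance (g + s) (w j)) \<in> (\<Pi>\<^sub>M j\<in>insert i J. paths) \<rightarrow>\<^sub>M (\<Pi>\<^sub>M j\<in>insert i J. paths)"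
    by measurable
  have [measurable]: "{w \<in> space (\<Pi>\<^sub>M j\<in>insert i J. paths). \<forall>j\<in>insert i J. g < fst (shd (w j))} \<in> sets (\<Pi>\<^sub>M j\<in>insert i J. paths)"
    using insert.hyps(1) by measurable
  have "(\<integral>\<^sup>+w. indicator {w. \<forall>j\<in>insert i J. g < fst (shd (w j))} w *
      F (\<lambda>j\<in>insert i J. advance (g + s) (w j)) \<partial>?P (insert i J)) =
    (\<integral>\<^sup>+w. indicator {w \<in> space (\<Pi>\<^sub>M j\<in>insert i J. paths). \<forall>j\<in>insert i J. g < fst (shd (w j))} w *
      F (\<lambda>j\<in>insert i J. advance (g + s) (w j)) \<partial>?P (insert i J))"
    by (intro nn_integral_cong) (auto simp: indicator_def sets_eq_imp_space_eq[OF sets_PiM_marked_poisson])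
  also have "\<dots> = (\<integral>\<^sup>+y. \<integral>\<^sup>+x. indicator {y. g < fst (shd y)} y *
      (indicator {w. \<forall>j\<in>J. g < fst (shd (w j))} x *
        F ((\<lambda>j\<in>J. advance (g + s) (x j))(i := advance (g + s) y))) \<partial>?P J \<partial>marked_poisson (l i) (\<sigma> i))"
  proof (subst P.product_nn_integral_insert_rev[OF insert.hyps], measurable, intro nn_integral_cong)
    fix y x assume "y \<in> space (marked_poisson (l i) (\<sigma> i))" and x: "x \<in> space (?P J)"
    have "x(i := y) \<in> space (\<Pi>\<^sub>M j\<in>insert i J. paths)"
      using x by (auto simp: space_PiM PiE_def extensional_def space_stream_space space_pair_measure)
    moreover have "(\<forall>j\<in>insert i J. g < fst (shd ((x(i := y)) j))) \<longleftrightarrow>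
        g < fst (shd y) \<and> (\<forall>j\<in>J. g < fst (shd (x j)))"
      using insert.hyps by auto
    moreover have "(\<lambda>j\<in>insert i J. advance (g + s) ((x(i := y)) j)) =
        (\<lambda>j\<in>J. advance (g + s) (x j))(i := advance (g + s) y)"
      using insert.hyps by (auto simp: fun_eq_iff)
    ultimately show "indicator {w \<in> space (\<Pi>\<^sub>M j\<in>insert i J. paths). \<forall>j\<in>insert i J. g < fst (shd (w j))} (x(i := y)) *
        F (\<lambda>j\<in>insert i J. advance (g + s) ((x(i := y)) j)) =
        indicator {y. g < fst (shd y)} y * (indicator {w. \<forall>j\<in>J. g < fst (shd (w j))} x *
        F ((\<lambda>j\<in>J. advance (g + s) (x j))(i := advance (g + s) y)))"
      by (simp add: indicator_def)
  qed
  also have "\<dots> = (\<integral>\<^sup>+y. indicator {y. g < fst (shd y)} y *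
      (ennreal (exp (- (\<Sum>j\<in>J. l j) * g)) * G (advance (g + s) y)) \<partial>marked_poisson (l i) (\<sigma> i))"
  proof (intro nn_integral_cong)
    fix y
    have "(\<lambda>x. F (x(i := advance (g + s) y))) \<in> borel_measurable (\<Pi>\<^sub>M j\<in>J. paths)"
      by (intro measurable_compose[OF measurable_fun_upd insert.prems]) auto
    note [measurable] = this
    show "(\<integral>\<^sup>+x. indicator {y. g < fst (shd y)} y * (indicator {w. \<forall>j\<in>J. g < fst (shd (w j))} x *
        F ((\<lambda>j\<in>J. advance (g + s) (x j))(i := advance (g + s) y))) \<partial>?P J) =
      indicator {y. g < fst (shd y)} y *
      (ennreal (exp (- (\<Sum>j\<in>J. l j) * g)) * G (advance (g + s) y))"
      using insert.IH[of "\<lambda>x. F (x(i := advance (g + s) y))"]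
      by (cases "g < fst (shd y)") (simp_all add: G_def restrict_def)
  qed
  also have "\<dots> = ennreal (exp (- (\<Sum>j\<in>J. l j) * g)) * (\<integral>\<^sup>+y. indicator {y. g < fst (shd y)} y *
      G (advance (g + s) y) \<partial>marked_poisson (l i) (\<sigma> i))"
  proof -
    have [measurable]: "{y. g < fst (shd y)} \<in> sets paths"
      by (rule sets_Collect_paths) measurable
    show ?thesis
      by (subst nn_integral_cmult[symmetric], measurable) (simp add: mult_ac)
  qed
  also have "\<dots> = ennreal (exp (- (\<Sum>j\<in>J. l j) * g)) * (ennreal (exp (- l i * g)) *
      (\<integral>\<^sup>+y. G y \<partial>marked_poisson (l i) (\<sigma> i)))"
    using assms(2,3) by (simp add: cl.nn_integral_advance_past)
  also have "(\<integral>\<^sup>+y. G y \<partial>marked_poisson (l i) (\<sigma> i)) = (\<integral>\<^sup>+w. F w \<partial>?P (insert i J))"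
    unfolding G_def by (subst P.product_nn_integral_insert_rev[OF insert.hyps]) simp_all
  also have "ennreal (exp (- (\<Sum>j\<in>J. l j) * g)) * (ennreal (exp (- l i * g)) * (\<integral>\<^sup>+w. F w \<partial>?P (insert i J))) =
      ennreal (exp (- (\<Sum>j\<in>insert i J. l j) * g)) * (\<integral>\<^sup>+w. F w \<partial>?P (insert i J))"
    using insert.hyps
    by (simp add: mult.assoc[symmetric] ennreal_mult[symmetric] exp_add[symmetric] algebra_simps)
  finally show ?case .
qed

text \<open>
  The path of the leading class is split at its first point \<open>(g, s)\<close>. The other classes have no
  arrival before \<open>g\<close>, which contributes the exponential factor, and they restart afresh by
  \<open>nn_integral_advance_past_all\<close>; the remaining path of the leading class is merely advanced by \<open>s\<close>
  and keeps its law by stationarity.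
\<close>

lemma nn_integral_restart_leads:
  assumes k: "k \<in> I"
    and F: "F \<in> borel_measurable ((borel \<Otimes>\<^sub>M borel) \<Otimes>\<^sub>M world)"
  shows "(\<integral>\<^sup>+w. indicator {w. leads k w} w * F (snd (head w), restart w) \<partial>superposed) =
    (\<integral>\<^sup>+g. ennreal (exp (- (total_rate - l k) * g)) *
      (\<integral>\<^sup>+s. \<integral>\<^sup>+w. F ((g, s), w) \<partial>superposed \<partial>\<sigma> k) \<partial>exponential (l k))"
proof -
  note F[measurable]
  let ?J = "I - {k}"
  have I_eq: "insert k ?J = I" using k by blast
  let ?P = "\<Pi>\<^sub>M j\<in>?J. marked_poisson (l j) (\<sigma> j)" and ?M = "marked_poisson (l k) (\<sigma> k)"
  interpret J: prob_space ?P
    by (intro prob_space_PiM cl.prob_space_axioms)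
  have rate: "(\<Sum>j\<in>?J. l j) = total_rate - l k"
    unfolding total_rate_def using k finite_classes by (simp add: sum_diff1)
  have split: "(\<integral>\<^sup>+w. h w \<partial>superposed) = (\<integral>\<^sup>+y. \<integral>\<^sup>+x. h (x(k := y)) \<partial>?P \<partial>?M)"
    if "h \<in> borel_measurable world" for h
    using P.product_nn_integral_insert_rev[of ?J k h] that finite_classes
    unfolding I_eq superposed_def by simp
  have upd[measurable]: "(\<lambda>(y, x). x(k := y)) \<in> paths \<Otimes>\<^sub>M ?P \<rightarrow>\<^sub>M world"
    unfolding case_prod_beta' by (rule measurable_fun_upd[where J="?J"]) (use k in auto)
  have upd'[measurable]: "(\<lambda>x. x(k := y)) \<in> ?P \<rightarrow>\<^sub>M world" for y
    by (rule measurable_fun_upd[where J="?J"]) (use k in auto)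
  have meas: "(\<lambda>w. indicator {w. leads k w} w * F (snd (head w), restart w)) \<in> borel_measurable world"
  proof -
    have "(\<lambda>w. indicator {w \<in> space world. leads k w} w * F (snd (head w), restart w)) \<in> borel_measurable world"
      by measurable
    then show ?thesis
      by (subst measurable_cong) (auto simp: indicator_def)
  qed
  \<comment> \<open>the classes other than \<open>k\<close> are integrated out after their restart\<close>
  define H where "H g s X = (\<integral>\<^sup>+x. F ((g, s), x(k := X)) \<partial>?P)" for g s X
  have [measurable]: "(\<lambda>(p, X). H (fst p) (snd p) X) \<in> borel_measurable ((borel \<Otimes>\<^sub>M borel) \<Otimes>\<^sub>M paths)"
    unfolding H_def by measurable
  have "(\<integral>\<^sup>+w. indicator {w. leads k w} w * F (snd (head w), restart w) \<partial>superposed) =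
      (\<integral>\<^sup>+y. \<integral>\<^sup>+x. indicator {x. \<forall>j\<in>?J. fst (shd y) < fst (shd (x j))} x *
        F (shd y, (\<lambda>j\<in>?J. advance (fst (shd y) + snd (shd y)) (x j))(k := advance (fst (shd y) + snd (shd y)) y)) \<partial>?P \<partial>?M)"
  proof (subst split[OF meas], intro nn_integral_cong)
    fix y x
    show "indicator {w. leads k w} (x(k := y)) * F (snd (head (x(k := y))), restart (x(k := y))) =
      indicator {x. \<forall>j\<in>?J. fst (shd y) < fst (shd (x j))} x *
        F (shd y, (\<lambda>j\<in>?J. advance (fst (shd y) + snd (shd y)) (x j))(k := advance (fst (shd y) + snd (shd y)) y))"
    proof (cases "leads k (x(k := y))")
      case True
      then have head: "head (x(k := y)) = (k, shd y)"
        using k by (simp add: head_def leader_eq)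
      have "advance_all d (x(k := y)) = (\<lambda>j\<in>?J. advance d (x j))(k := advance d y)" for d
        using k by (auto simp: advance_all_def fun_eq_iff)
      with True head show ?thesis
        by (simp add: restart_def case_prod_beta' indicator_def leads_def)
    next
      case False
      then show ?thesis by (auto simp: leads_def)
    qed
  qed
  also have "\<dots> = (\<integral>\<^sup>+y. ennreal (exp (- (total_rate - l k) * fst (shd y))) *
      H (fst (shd y)) (snd (shd y)) (advance (fst (shd y) + snd (shd y)) y) \<partial>?M)"
  proof (rule nn_integral_cong_AE)
    have "AE g in exponential (l k). AE s in \<sigma> k. 0 \<le> fst (g, s) \<and> 0 \<le> snd (g, s)"
      using exponential_nonneg[OF cl.rate_pos]
      by eventually_elim (use mark_nonneg[OF k] in simp)
    then have "AE y in ?M. \<forall>j. 0 \<le> fst (y !! j) \<and> 0 \<le> snd (y !! j)"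
      by (intro cl.AE_points) measurable
    then show "AE y in ?M. (\<integral>\<^sup>+x. indicator {x. \<forall>j\<in>?J. fst (shd y) < fst (shd (x j))} x *
        F (shd y, (\<lambda>j\<in>?J. advance (fst (shd y) + snd (shd y)) (x j))(k := advance (fst (shd y) + snd (shd y)) y)) \<partial>?P) =
      ennreal (exp (- (total_rate - l k) * fst (shd y))) *
      H (fst (shd y)) (snd (shd y)) (advance (fst (shd y) + snd (shd y)) y)"
    proof eventually_elim
      fix y :: "(real \<times> real) stream"
      assume "\<forall>j. 0 \<le> fst (y !! j) \<and> 0 \<le> snd (y !! j)"
      from this[rule_format, of 0] have *: "0 \<le> fst (shd y)" "0 \<le> snd (shd y)"
        by simp_all
      show "(\<integral>\<^sup>+x. indicator {x. \<forall>j\<in>?J. fst (shd y) < fst (shd (x j))} x *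
        F (shd y, (\<lambda>j\<in>?J. advance (fst (shd y) + snd (shd y)) (x j))(k := advance (fst (shd y) + snd (shd y)) y)) \<partial>?P) =
      ennreal (exp (- (total_rate - l k) * fst (shd y))) *
      H (fst (shd y)) (snd (shd y)) (advance (fst (shd y) + snd (shd y)) y)"
        using nn_integral_advance_past_all[of ?J "fst (shd y)" "snd (shd y)"
            "\<lambda>x. F (shd y, x(k := advance (fst (shd y) + snd (shd y)) y))", OF _ *] finite_classes
        unfolding rate H_def by simp
    qed
  qed
  also have "\<dots> = (\<integral>\<^sup>+g. \<integral>\<^sup>+s. \<integral>\<^sup>+X. ennreal (exp (- (total_rate - l k) * g)) *
      H g s (advance (g + s) ((g, s) ## X)) \<partial>?M \<partial>\<sigma> k \<partial>exponential (l k))"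
    by (subst cl.nn_integral_marked_poisson) simp_all
  also have "\<dots> = (\<integral>\<^sup>+g. \<integral>\<^sup>+s. ennreal (exp (- (total_rate - l k) * g)) *
      (\<integral>\<^sup>+X. H g s X \<partial>?M) \<partial>\<sigma> k \<partial>exponential (l k))"
  proof (rule nn_integral_cong, rule nn_integral_cong_AE)
    fix g :: real
    show "AE s in \<sigma> k. (\<integral>\<^sup>+X. ennreal (exp (- (total_rate - l k) * g)) *
        H g s (advance (g + s) ((g, s) ## X)) \<partial>?M) =
      ennreal (exp (- (total_rate - l k) * g)) * (\<integral>\<^sup>+X. H g s X \<partial>?M)"
      using mark_nonneg[OF k]
    proof eventually_elim
      fix s :: real assume "0 \<le> s"
      have "(\<lambda>X. H (fst (g, s)) (snd (g, s)) X) \<in> borel_measurable paths"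
        by measurable
      then have [measurable]: "H g s \<in> borel_measurable paths" by simp
      have "(\<integral>\<^sup>+X. H g s (advance (g + s) ((g, s) ## X)) \<partial>?M) = (\<integral>\<^sup>+X. H g s (advance s X) \<partial>?M)"
      proof (rule nn_integral_cong_AE)
        show "AE X in ?M. H g s (advance (g + s) ((g, s) ## X)) = H g s (advance s X)"
          using cl.AE_arrival_beyond[of s k]
        proof eventually_elim
          fix X assume "\<exists>j. s < arrival X j"
          then obtain j where "s < arrival ((0, s) ## X) (Suc j)"
            by (auto simp: arrival_SCons_Suc)
          then have "advance s ((0, s) ## X) = advance s X"
            using \<open>0 \<le> s\<close> by (subst advance_after_first) auto
          then show "H g s (advance (g + s) ((g, s) ## X)) = H g s (advance s X)"
            using advance_reduce[of s g g s X] by (simp add: add.commute)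
        qed
      qed
      also have "\<dots> = (\<integral>\<^sup>+X. H g s X \<partial>?M)"
        using \<open>0 \<le> s\<close> \<open>H g s \<in> _\<close> by (rule cl.nn_integral_advance)
      finally show "(\<integral>\<^sup>+X. ennreal (exp (- (total_rate - l k) * g)) *
          H g s (advance (g + s) ((g, s) ## X)) \<partial>?M) =
        ennreal (exp (- (total_rate - l k) * g)) * (\<integral>\<^sup>+X. H g s X \<partial>?M)"
        by (subst nn_integral_cmult) simp_all
    qed
  qed
  also have "\<dots> = (\<integral>\<^sup>+g. ennreal (exp (- (total_rate - l k) * g)) *
      (\<integral>\<^sup>+s. \<integral>\<^sup>+w. F ((g, s), w) \<partial>superposed \<partial>\<sigma> k) \<partial>exponential (l k))"
    by (simp add: H_def split nn_integral_cmult)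
  finally show ?thesis .
qed

lemma total_rate_pos: "0 < total_rate"
  unfolding total_rate_def using finite_classes nonempty_classes cl.rate_pos by (intro sum_pos) auto

text \<open>
  The density of the arrival of class \<open>k\<close>, multiplied by the probability that all other classes are
  later, is the share of class \<open>k\<close> times the exponential density of the total rate. Hence the winning
  class is independent of the winning time.
\<close>

lemma nn_integral_competing_exponential:
  assumes [measurable]: "h \<in> borel_measurable borel"
  shows "(\<integral>\<^sup>+g. ennreal (exp (- (total_rate - l k) * g)) * h g \<partial>exponential (l k)) =
    ennreal (l k / total_rate) * (\<integral>\<^sup>+g. h g \<partial>exponential total_rate)"
proof -
  have *: "ennreal (exponential_density (l k) g) * ennreal (exp (- (total_rate - l k) * g)) =
      ennreal (l k / total_rate) * ennreal (exponential_density total_rate g)" for g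
  proof -
    have "exponential_density (l k) g * exp (- (total_rate - l k) * g) =
        l k / total_rate * exponential_density total_rate g"
      using total_rate_pos by (simp add: exponential_density_def exp_add[symmetric] algebra_simps)
    then show ?thesis
      using total_rate_pos cl.rate_pos[of k]
      by (simp add: ennreal_mult[symmetric] exponential_density_nonneg)
  qed
  have "(\<integral>\<^sup>+g. ennreal (exp (- (total_rate - l k) * g)) * h g \<partial>exponential (l k)) =
      (\<integral>\<^sup>+g. ennreal (exponential_density (l k) g) * ennreal (exp (- (total_rate - l k) * g)) * h g \<partial>lborel)"
    by (simp add: nn_integral_density mult.assoc)
  also have "\<dots> = (\<integral>\<^sup>+g. ennreal (l k / total_rate) * (ennreal (exponential_density total_rate g) * h g) \<partial>lborel)"
    unfolding * by (simp add: mult.assoc)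
  also have "\<dots> = ennreal (l k / total_rate) * (\<integral>\<^sup>+g. h g \<partial>exponential total_rate)"
    by (simp add: nn_integral_density nn_integral_cmult)
  finally show ?thesis .
qed

lemma AE_leads: "AE w in superposed. \<exists>k\<in>I. leads k w"
proof -
  have [measurable]: "{w. leads k w} \<inter> space world \<in> sets world" for k
  proof -
    have "{w \<in> space world. leads k w} \<in> sets world" by measurable
    then show ?thesis by (simp add: Int_def conj_commute)
  qed
  have "emeasure superposed {w \<in> space world. leads k w} = ennreal (l k / total_rate)" if "k \<in> I" for k
  proof -
    have "emeasure superposed {w \<in> space world. leads k w} =
        (\<integral>\<^sup>+w. indicator {w \<in> space world. leads k w} w \<partial>superposed)" by simp
    also have "\<dots> = (\<integral>\<^sup>+w. indicator {w. leads k w} w * 1 \<partial>superposed)"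
      by (intro nn_integral_cong) (auto simp: indicator_def sets_eq_imp_space_eq[OF sets_superposed])
    also have "\<dots> = ennreal (l k / total_rate)"
      using nn_integral_restart_leads[OF that, of "\<lambda>_. 1"] nn_integral_competing_exponential[of "\<lambda>_. 1" k]
        prob_space.emeasure_space_1[OF prob_space_exponential_density[OF total_rate_pos]]
      by (simp add: S.emeasure_space_1 cl.mark.emeasure_space_1)
    finally show ?thesis .
  qed
  then have "(\<Sum>k\<in>I. emeasure superposed {w \<in> space world. leads k w}) = (\<Sum>k\<in>I. ennreal (l k / total_rate))"
    by simp
  also have "\<dots> = 1"
    using total_rate_pos cl.rate_pos
    by (subst sum_ennreal) (auto simp: less_imp_le sum_divide_distrib[symmetric] total_rate_def[symmetric])
  also have "(\<Sum>k\<in>I. emeasure superposed {w \<in> space world. leads k w}) =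
      emeasure superposed (\<Union>k\<in>I. {w \<in> space world. leads k w})"
    using finite_classes
    by (intro sum_emeasure) (auto simp: disjoint_family_on_def dest: leads_unique)
  finally have "S.prob (\<Union>k\<in>I. {w \<in> space world. leads k w}) = 1"
    by (simp add: S.emeasure_eq_measure)
  then have "AE w in superposed. w \<in> (\<Union>k\<in>I. {w \<in> space world. leads k w})"
    using finite_classes by (subst (asm) S.prob_eq_1) auto
  then show ?thesis by eventually_elim auto
qed

text \<open>
  The strong Markov property at a departure, together with the law of a cycle: the class is drawn in
  proportion to the rates, the idle time is exponential with the total rate, the service time has
  the law of the class, and the restarted paths are independent of all three.
\<close>

theorem nn_integral_head_restart:
  assumes F: "F \<in> borel_measurable ((count_space UNIV \<Otimes>\<^sub>M (borel \<Otimes>\<^sub>M borel)) \<Otimes>\<^sub>M world)"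
  shows "(\<integral>\<^sup>+w. F (head w, restart w) \<partial>superposed) =
    (\<Sum>k\<in>I. ennreal (l k / total_rate) *
      (\<integral>\<^sup>+g. \<integral>\<^sup>+s. \<integral>\<^sup>+w. F ((k, g, s), w) \<partial>superposed \<partial>\<sigma> k \<partial>exponential total_rate))"
proof -
  note F[measurable]
  have "(\<integral>\<^sup>+w. F (head w, restart w) \<partial>superposed) =
      (\<integral>\<^sup>+w. (\<Sum>k\<in>I. indicator {w \<in> space world. leads k w} w * F ((k, snd (head w)), restart w)) \<partial>superposed)"
  proof (rule nn_integral_cong_AE)
    show "AE w in superposed. F (head w, restart w) =
        (\<Sum>k\<in>I. indicator {w \<in> space world. leads k w} w * F ((k, snd (head w)), restart w))"
      using AE_leads AE_space
    proof eventually_elim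
      fix w assume "\<exists>k\<in>I. leads k w" and w: "w \<in> space superposed"
      then obtain k where k: "k \<in> I" "leads k w" by blast
      have "(\<Sum>j\<in>I. indicator {w \<in> space world. leads j w} w * F ((j, snd (head w)), restart w)) =
          (\<Sum>j\<in>I. if j = k then F ((k, snd (head w)), restart w) else 0)"
      proof (rule sum.cong)
        fix j assume "j \<in> I"
        then have "leads j w \<longleftrightarrow> j = k"
          using k leads_unique by blast
        with w show "indicator {w \<in> space world. leads j w} w * F ((j, snd (head w)), restart w) =
            (if j = k then F ((k, snd (head w)), restart w) else 0)"
          by (simp add: indicator_def sets_eq_imp_space_eq[OF sets_superposed])
      qed simp
      also have "\<dots> = F ((k, snd (head w)), restart w)"
        using k finite_classes by simp
      also have "(k, snd (head w)) = head w"
        using k by (simp add: head_def leader_eq)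
      finally show "F (head w, restart w) =
        (\<Sum>k\<in>I. indicator {w \<in> space world. leads k w} w * F ((k, snd (head w)), restart w))" by simp
    qed
  qed
  also have "\<dots> = (\<Sum>k\<in>I. \<integral>\<^sup>+w. indicator {w \<in> space world. leads k w} w * F ((k, snd (head w)), restart w) \<partial>superposed)"
    by (rule nn_integral_sum) measurable
  also have "\<dots> = (\<Sum>k\<in>I. ennreal (l k / total_rate) *
      (\<integral>\<^sup>+g. \<integral>\<^sup>+s. \<integral>\<^sup>+w. F ((k, g, s), w) \<partial>superposed \<partial>\<sigma> k \<partial>exponential total_rate))"
  proof (rule sum.cong)
    fix k assume k: "k \<in> I"
    have [measurable]: "(\<lambda>p. F ((k, fst p), snd p)) \<in> borel_measurable ((borel \<Otimes>\<^sub>M borel) \<Otimes>\<^sub>M world)"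
      by measurable
    have "(\<integral>\<^sup>+w. indicator {w \<in> space world. leads k w} w * F ((k, snd (head w)), restart w) \<partial>superposed) =
        (\<integral>\<^sup>+w. indicator {w. leads k w} w * F ((k, snd (head w)), restart w) \<partial>superposed)"
      by (intro nn_integral_cong) (auto simp: indicator_def sets_eq_imp_space_eq[OF sets_superposed])
    also have "\<dots> = ennreal (l k / total_rate) *
      (\<integral>\<^sup>+g. \<integral>\<^sup>+s. \<integral>\<^sup>+w. F ((k, g, s), w) \<partial>superposed \<partial>\<sigma> k \<partial>exponential total_rate)"
      using nn_integral_restart_leads[OF k, of "\<lambda>p. F ((k, fst p), snd p)"]
      by (subst nn_integral_competing_exponential[symmetric]) simp_all
    finally show "(\<integral>\<^sup>+w. indicator {w \<in> space world. leads k w} w * F ((k, snd (head w)), restart w) \<partial>superposed) = \<dots>" .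
  qed simp
  finally show ?thesis .
qed

lemma nn_integral_head:
  assumes [measurable]: "h \<in> borel_measurable (count_space UNIV \<Otimes>\<^sub>M (borel \<Otimes>\<^sub>M borel))"
  shows "(\<integral>\<^sup>+w. h (head w) \<partial>superposed) = (\<Sum>k\<in>I. ennreal (l k / total_rate) *
      (\<integral>\<^sup>+g. \<integral>\<^sup>+s. h (k, g, s) \<partial>\<sigma> k \<partial>exponential total_rate))"
  using nn_integral_head_restart[of "\<lambda>p. h (fst p)"] by (simp add: S.emeasure_space_1)

sublocale cycle: regenerative superposed "count_space UNIV \<Otimes>\<^sub>M (borel \<Otimes>\<^sub>M borel)" head restart
proof
  fix F :: "(nat \<times> real \<times> real) \<times> (nat \<Rightarrow> (real \<times> real) stream) \<Rightarrow> ennreal"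
  assume "F \<in> borel_measurable ((count_space UNIV \<Otimes>\<^sub>M borel \<Otimes>\<^sub>M borel) \<Otimes>\<^sub>M superposed)"
  then have [measurable]: "F \<in> borel_measurable ((count_space UNIV \<Otimes>\<^sub>M borel \<Otimes>\<^sub>M borel) \<Otimes>\<^sub>M world)"
    by (simp cong: measurable_cong_sets add: measurable_cong_sets[OF sets_pair_measure_cong[OF refl sets_superposed] refl])
  show "(\<integral>\<^sup>+w. F (head w, restart w) \<partial>superposed) = (\<integral>\<^sup>+w. \<integral>\<^sup>+v. F (head w, v) \<partial>superposed \<partial>superposed)"
    by (subst nn_integral_head_restart, measurable)
       (subst nn_integral_head[of "\<lambda>y. \<integral>\<^sup>+v. F (y, v) \<partial>superposed"], simp_all)
qed measurable

text \<open>
  The properties of a realisation under which the recursion of the queue can be followed for one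
  cycle without ambiguity.
\<close>

definition regular :: "(nat \<Rightarrow> (real \<times> real) stream) \<Rightarrow> bool" where
  "regular w \<longleftrightarrow> (\<exists>k\<in>I. leads k w) \<and>
    (\<forall>k\<in>I. (\<forall>j. 0 < fst (w k !! j) \<and> 0 \<le> snd (w k !! j)) \<and> (\<forall>t. \<exists>j. t < arrival (w k) j))"

lemma AE_regular: "AE w in superposed. regular w"
proof -
  have "AE w in superposed. (\<forall>j. 0 < fst (w k !! j) \<and> 0 \<le> snd (w k !! j)) \<and> (\<forall>t. \<exists>j. t < arrival (w k) j)"
    if k: "k \<in> I" for k
  proof -
    have "AE g in exponential (l k). AE s in \<sigma> k. 0 < fst (g, s) \<and> 0 \<le> snd (g, s)"
      using exponential_pos[OF cl.rate_pos]
      by eventually_elim (use mark_nonneg[OF k] in simp)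
    then have points: "AE X in marked_poisson (l k) (\<sigma> k). \<forall>j. 0 < fst (X !! j) \<and> 0 \<le> snd (X !! j)"
      by (intro cl.AE_points) measurable
    have "AE X in marked_poisson (l k) (\<sigma> k). \<forall>n. \<exists>j. real n < arrival X j"
      unfolding AE_all_countable by (intro allI cl.AE_arrival_beyond)
    with points have "AE X in marked_poisson (l k) (\<sigma> k).
        (\<forall>j. 0 < fst (X !! j) \<and> 0 \<le> snd (X !! j)) \<and> (\<forall>t. \<exists>j. t < arrival X j)"
      by eventually_elim (meson le_less_trans real_arch_simple)
    then show ?thesis
      unfolding superposed_def using k by (intro AE_PiM_component cl.prob_space_axioms)
  qed
  then have "AE w in superposed. \<forall>k\<in>I. (\<forall>j. 0 < fst (w k !! j) \<and> 0 \<le> snd (w k !! j)) \<and> (\<forall>t. \<exists>j. t < arrival (w k) j)"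
    using finite_classes by (intro AE_finite_allI) auto
  with AE_leads show ?thesis
    by eventually_elim (simp add: regular_def)
qed

lemma regular_head:
  assumes "regular w" and "head w = (k, g, s)"
  shows "k \<in> I" "leads k w" "shd (w k) = (g, s)" "0 < g" "0 \<le> s"
proof -
  from assms(1) obtain j where j: "j \<in> I" "leads j w"
    by (auto simp: regular_def)
  with assms(2) have "j = k" and shd: "shd (w k) = (g, s)"
    by (auto simp: head_def leader_eq)
  with j show "k \<in> I" "leads k w" "shd (w k) = (g, s)" by simp_all
  then have "0 < fst (w k !! 0) \<and> 0 \<le> snd (w k !! 0)"
    using assms(1) unfolding regular_def by blast
  with shd show "0 < g" "0 \<le> s" by simp_all
qed

end

locale served_classes = poisson_classes +
  fixes x :: "nat \<Rightarrow> real"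
  assumes mean_mark: "\<And>k. k \<in> I \<Longrightarrow> (\<integral>\<^sup>+s. ennreal s \<partial>\<sigma> k) = ennreal (x k)"
    and mean_nonneg: "\<And>k. k \<in> I \<Longrightarrow> 0 \<le> x k"
begin

lemma emeasure_exponential_total [simp]: "emeasure (exponential total_rate) UNIV = 1"
  using prob_space.emeasure_space_1[OF prob_space_exponential_density[OF total_rate_pos]] by simp

lemma share_nonneg: "0 \<le> l k / total_rate"
  using cl.rate_pos[of k] total_rate_pos by simp

lemma mean_gap:
  "has_bochner_integral superposed (\<lambda>w. fst (snd (head w))) (1 / total_rate)"
proof (rule has_bochner_integral_nn_integral)
  show "AE w in superposed. 0 \<le> fst (snd (head w))"
    using AE_regular by eventually_elim (metis less_imp_le prod.collapse regular_head(4))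
  have gap: "(\<integral>\<^sup>+g. ennreal g \<partial>exponential total_rate) = ennreal (1 / total_rate)"
  proof -
    have "(\<integral>\<^sup>+g. ennreal g \<partial>exponential total_rate) =
        (\<integral>\<^sup>+g. ennreal (exponential_density total_rate g * g ^ 1) \<partial>lborel)"
      using total_rate_pos
      by (simp add: nn_integral_density ennreal_mult'' exponential_density_nonneg ennreal_mult'[symmetric])
    also have "\<dots> = ennreal (1 / total_rate)"
      using nn_integral_erlang_ith_moment[OF total_rate_pos, of 0 1] by simp
    finally show ?thesis .
  qed
  have "(\<Sum>k\<in>I. ennreal (l k / total_rate)) = 1"
    using total_rate_pos share_nonneg
    by (subst sum_ennreal) (auto simp: sum_divide_distrib[symmetric] total_rate_def[symmetric])
  then show "(\<integral>\<^sup>+w. ennreal (fst (snd (head w))) \<partial>superposed) = ennreal (1 / total_rate)"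
    by (subst nn_integral_head, measurable)
      (simp add: cl.mark.emeasure_space_1 gap sum_distrib_right[symmetric])
qed (use total_rate_pos in simp_all)

lemma mean_class_weight:
  assumes c: "\<And>k. 0 \<le> c k"
  shows "has_bochner_integral superposed (\<lambda>w. c (fst (head w))) (\<Sum>k\<in>I. l k / total_rate * c k)"
proof (rule has_bochner_integral_nn_integral)
  show "(\<integral>\<^sup>+w. ennreal (c (fst (head w))) \<partial>superposed) = ennreal (\<Sum>k\<in>I. l k / total_rate * c k)"
    using c share_nonneg
    by (subst nn_integral_head, measurable)
      (simp add: cl.mark.emeasure_space_1 ennreal_mult[symmetric] sum_ennreal del: times_divide_eq_left)
qed (use c share_nonneg in \<open>auto intro!: sum_nonneg simp del: times_divide_eq_left\<close>)

lemma mean_weighted_mark: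
  assumes c: "\<And>k. 0 \<le> c k"
  shows "has_bochner_integral superposed (\<lambda>w. c (fst (head w)) * snd (snd (head w)))
    (\<Sum>k\<in>I. l k / total_rate * (c k * x k))"
proof (rule has_bochner_integral_nn_integral)
  show "AE w in superposed. 0 \<le> c (fst (head w)) * snd (snd (head w))"
    using AE_regular by eventually_elim (metis c mult_nonneg_nonneg prod.collapse regular_head(5))
  have "(\<integral>\<^sup>+s. ennreal (c k * s) \<partial>\<sigma> k) = ennreal (c k * x k)" if "k \<in> I" for k
    using that c by (simp add: ennreal_mult' nn_integral_cmult mean_mark)
  then show "(\<integral>\<^sup>+w. ennreal (c (fst (head w)) * snd (snd (head w))) \<partial>superposed) =
      ennreal (\<Sum>k\<in>I. l k / total_rate * (c k * x k))"
    using c share_nonneg mean_nonneg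
    by (subst nn_integral_head, measurable)
      (simp add: ennreal_mult[symmetric] sum_ennreal del: times_divide_eq_left)
qed (use c share_nonneg mean_nonneg in \<open>auto intro!: sum_nonneg mult_nonneg_nonneg simp del: times_divide_eq_left\<close>)

end

section \<open>Sample paths of the queue\<close>

text \<open>
  A strict minimiser is the only one, so the arbitrary choice made by \<open>ARG_MIN\<close> is determined.
\<close>

lemma next_arrival_eqI:
  assumes "k \<in> {1..N}" "t < a k c"
    and "\<And>k' j. k' \<in> {1..N} \<Longrightarrow> (k', j) \<noteq> (k, c) \<Longrightarrow> t < a k' j \<Longrightarrow> a k c < a k' j"
  shows "next_arrival N a t = (k, c)"
  unfolding next_arrival_def arg_min_def
proof (rule some_equality)
  let ?f = "\<lambda>(k, j). a k j" and ?P = "\<lambda>p. p \<in> {1..N} \<times> UNIV \<and> t < a (fst p) (snd p)"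
  have P: "?P (k, c)" using assms by simp
  have least: "?f (k, c) < ?f q" if "?P q" "q \<noteq> (k, c)" for q
    using assms(3)[of "fst q" "snd q"] that by (cases q) auto
  show "is_arg_min ?f ?P (k, c)"
    unfolding is_arg_min_def using P least by (metis less_asym less_irrefl)
  show "q = (k, c)" if "is_arg_min ?f ?P q" for q
    using that P least unfolding is_arg_min_def by blast
qed

lemma arrival_strict_mono:
  assumes "\<And>j. 0 < fst (X !! j)" "i < j"
  shows "arrival X i < arrival X j"
  using assms(2) by (rule lift_Suc_mono_less[rotated]) (use assms(1) in \<open>simp add: arrival_Suc del: snth.simps\<close>)

lemma arrival_mono:
  assumes "\<And>j. 0 < fst (X !! j)"
  shows "arrival X 0 \<le> arrival X j"
  using arrival_strict_mono[of X 0 j] assms by (cases "j = 0") (auto simp: less_imp_le)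

lemma sum_enumerate:
  fixes f :: "nat \<Rightarrow> real"
  assumes C: "infinite C"
  shows "(\<Sum>k<K. f (enumerate C k)) = (\<Sum>i<enumerate C K. if i \<in> C then f i else 0)"
proof -
  have image: "enumerate C ` {..<K} = {i \<in> {..<enumerate C K}. i \<in> C}"
  proof (intro equalityI subsetI)
    fix i assume "i \<in> {i \<in> {..<enumerate C K}. i \<in> C}"
    then have "i \<in> C" "i < enumerate C K" by simp_all
    then obtain k where "i = enumerate C k" "enumerate C k < enumerate C K"
      using enumerate_Ex C by metis
    then show "i \<in> enumerate C ` {..<K}"
      using C by simp
  qed (use C enumerate_in_set in auto)
  have inj: "inj_on (enumerate C) {..<K}"
    using strict_mono_enumerate[OF C] strict_mono_imp_inj_on inj_on_subset by blast
  have "(\<Sum>k<K. f (enumerate C k)) = sum f (enumerate C ` {..<K})"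
    using inj by (simp add: sum.reindex)
  also have "\<dots> = (\<Sum>i<enumerate C K. if i \<in> C then f i else 0)"
    unfolding image by (rule sum.inter_filter) simp
  finally show ?thesis .
qed

text \<open>
  Between two successive receptions of class \<open>n\<close> the age refers to the earlier of the two packets, so
  the left limit at the later reception is taken along a function \<open>t - const\<close>.
\<close>

lemma peak_age_Suc:
  fixes N n a s \<delta>
  defines "e \<equiv> enumerate (class_served N a s n)"
  assumes inf: "infinite (class_served N a s n)"
    and rec: "strict_mono (reception_time N a s)"
  shows "peak_age N a s \<delta> n (Suc k) = reception_time N a s (e (Suc k)) - generation_time N a s (e k)"
proof -
  let ?r = "reception_time N a s" and ?g = "generation_time N a s"
  have e_less: "e k < e (Suc k)"
    unfolding e_def using inf by (rule enumerate_step)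
  have age: "status_age N a s \<delta> n t = t - ?g (e k)" if "?r (e k) \<le> t" "t < ?r (e (Suc k))" for t
  proof -
    have ek: "e k \<in> class_served N a s n"
      unfolding e_def using inf by (rule enumerate_in_set)
    have "(GREATEST m. m \<in> class_served N a s n \<and> ?r m \<le> t) = e k"
    proof (rule Greatest_equality)
      show "e k \<in> class_served N a s n \<and> ?r (e k) \<le> t" using ek that by simp
      fix m assume m: "m \<in> class_served N a s n \<and> ?r m \<le> t"
      then obtain i where i: "m = e i"
        unfolding e_def using enumerate_Ex inf by metis
      have "?r (e i) < ?r (e (Suc k))" using m that i by simp
      then have "e i < e (Suc k)" using rec by (simp add: strict_mono_less)
      then have "i < Suc k" unfolding e_def using inf by simp
      then show "m \<le> e k"
        unfolding i e_def using inf by simp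
    qed
    with ek that show ?thesis by (auto simp: status_age_def)
  qed
  have "eventually (\<lambda>t. t \<in> {?r (e k)<..<?r (e (Suc k))}) (at_left (?r (e (Suc k))))"
    using rec e_less by (intro eventually_at_left_real) (simp add: strict_mono_less)
  then have "eventually (\<lambda>t. t - ?g (e k) = status_age N a s \<delta> n t) (at_left (?r (e (Suc k))))"
    by eventually_elim (simp add: age)
  moreover have "((\<lambda>t. t - ?g (e k)) \<longlongrightarrow> ?r (e (Suc k)) - ?g (e k)) (at_left (?r (e (Suc k))))"
    by (intro tendsto_intros)
  ultimately have "(status_age N a s \<delta> n \<longlongrightarrow> ?r (e (Suc k)) - ?g (e k)) (at_left (?r (e (Suc k))))"
    by (rule Lim_transform_eventually[rotated])
  then show ?thesis
    unfolding peak_age_def e_def[symmetric] by (intro tendsto_Lim) simp_all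
qed

text \<open>
  A fixed realisation of the queue whose arrival epochs and service times are read off the paths
  \<open>w\<close>, and along which every restart leads to a regular state again.
\<close>

locale sample_path = poisson_classes +
  fixes N :: nat and w :: "nat \<Rightarrow> (real \<times> real) stream" and a s :: "nat \<Rightarrow> nat \<Rightarrow> real"
  assumes classes: "I = {1..N}"
    and a_eq: "\<And>k j. k \<in> I \<Longrightarrow> a k j = arrival (w k) j"
    and s_eq: "\<And>k j. k \<in> I \<Longrightarrow> s k j = snd (w k !! j)"
    and regular: "\<And>m. regular ((restart ^^ m) w)"
begin

definition cls :: "nat \<Rightarrow> nat" where "cls m = fst (head ((restart ^^ m) w))"
definition idle :: "nat \<Rightarrow> real" where "idle m = fst (snd (head ((restart ^^ m) w)))"
definition service :: "nat \<Rightarrow> real" where "service m = snd (snd (head ((restart ^^ m) w)))"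
text \<open>
  The start of cycle \<open>m\<close>: the time origin, or the departure of the packet that was admitted
  just before.
\<close>

definition epoch :: "nat \<Rightarrow> real" where "epoch m = (\<Sum>i<m. idle i + service i)"

lemma head_eq: "head ((restart ^^ m) w) = (cls m, idle m, service m)"
  by (simp add: cls_def idle_def service_def)

lemmas cycle = regular_head[OF regular head_eq]

text \<open>
  The invariant that ties the queue to the restarted paths: relative to the start of cycle \<open>m\<close>, the
  arrivals still to come in each class, with their service times, form the \<open>m\<close>-th restarted path.
  The witness \<open>c\<close> counts the arrivals of the class up to that time.
\<close>

definition aligned :: "nat \<Rightarrow> bool" where
  "aligned m \<longleftrightarrow> (\<forall>k\<in>I. \<exists>c.
    (\<forall>j. a k (c + j) = epoch m + arrival ((restart ^^ m) w k) j \<and>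
      s k (c + j) = snd ((restart ^^ m) w k !! j)) \<and>
    (\<forall>j<c. a k j \<le> epoch m))"

lemma aligned_Suc:
  assumes "aligned m" shows "aligned (Suc m)"
  unfolding aligned_def
proof
  fix k assume k: "k \<in> I"
  let ?X = "(restart ^^ m) w k" and ?d = "idle m + service m"
  obtain c where c: "\<And>j. a k (c + j) = epoch m + arrival ?X j" "\<And>j. s k (c + j) = snd (?X !! j)"
    "\<And>j. j < c \<Longrightarrow> a k j \<le> epoch m"
    using assms k unfolding aligned_def by meson
  have next_path: "(restart ^^ Suc m) w k = advance ?d ?X"
    using k by (simp add: restart_def head_eq advance_all_def)
  have epoch: "epoch (Suc m) = epoch m + ?d" by (simp add: epoch_def)
  have ex: "\<exists>j. ?d < arrival ?X j"
    using regular[of m] k unfolding regular_def by blast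
  define J where "J = (LEAST j. ?d < arrival ?X j)"
  have adv: "arrival (advance ?d ?X) j = arrival ?X (J + j) - ?d"
    "snd (advance ?d ?X !! j) = snd (?X !! (J + j))" for j
    unfolding J_def by (rule advance_snth[OF ex])+
  show "\<exists>c. (\<forall>j. a k (c + j) = epoch (Suc m) + arrival ((restart ^^ Suc m) w k) j \<and>
      s k (c + j) = snd ((restart ^^ Suc m) w k !! j)) \<and> (\<forall>j<c. a k j \<le> epoch (Suc m))"
  proof (intro exI[of _ "c + J"] conjI allI impI)
    fix j
    show "a k (c + J + j) = epoch (Suc m) + arrival ((restart ^^ Suc m) w k) j"
      unfolding next_path adv epoch using c(1)[of "J + j"] by (simp add: add.assoc)
    show "s k (c + J + j) = snd ((restart ^^ Suc m) w k !! j)"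
      unfolding next_path adv using c(2)[of "J + j"] by (simp add: add.assoc)
  next
    fix j assume j: "j < c + J"
    show "a k j \<le> epoch (Suc m)"
    proof (cases "j < c")
      case True
      then show ?thesis
        using c(3)[OF True] cycle(4,5)[of m] unfolding epoch by linarith
    next
      case False
      then obtain i where i: "j = c + i" "i < J"
        using j by (metis add_less_cancel_left le_add_diff_inverse not_less)
      then have "arrival ?X i \<le> ?d"
        unfolding J_def using not_less_Least not_less by blast
      then show ?thesis using c(1)[of i] i unfolding epoch by simp
    qed
  qed
qed

lemma aligned: "aligned m"
proof (induction m)
  case 0
  show ?case
    unfolding aligned_def by (intro ballI exI[of _ 0]) (simp add: epoch_def a_eq s_eq)
qed (rule aligned_Suc)

lemma next_arrival_epoch:
  obtains c where "next_arrival N a (epoch m) = (cls m, c)"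
    "a (cls m) c = epoch m + idle m" "s (cls m) c = service m"
proof -
  let ?w = "(restart ^^ m) w"
  have pos: "0 < fst (?w k !! j)" if "k \<in> I" for k j
    using regular[of m] that unfolding regular_def by blast
  obtain c where c: "\<And>j. a (cls m) (c + j) = epoch m + arrival (?w (cls m)) j"
    "\<And>j. s (cls m) (c + j) = snd (?w (cls m) !! j)" "\<And>j. j < c \<Longrightarrow> a (cls m) j \<le> epoch m"
    using aligned[of m] cycle(1)[of m] unfolding aligned_def by meson
  have first: "a (cls m) c = epoch m + idle m" "s (cls m) c = service m"
    using c(1,2)[of 0] cycle(3)[of m] by simp_all
  have "next_arrival N a (epoch m) = (cls m, c)"
  proof (rule next_arrival_eqI)
    show "cls m \<in> {1..N}" using cycle(1)[of m] by (simp add: classes)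
    show "epoch m < a (cls m) c" using first cycle(4)[of m] by simp
    fix k j assume k': "k \<in> {1..N}" "(k, j) \<noteq> (cls m, c)" and late: "epoch m < a k j"
    then have k: "k \<in> I" "(k, j) \<noteq> (cls m, c)" by (simp_all add: classes)
    obtain c' where c': "\<And>j. a k (c' + j) = epoch m + arrival (?w k) j" "\<And>j. j < c' \<Longrightarrow> a k j \<le> epoch m"
      using aligned[of m] k(1) unfolding aligned_def by meson
    obtain i where i: "j = c' + i"
      using c'(2)[of j] late by (metis le_add_diff_inverse not_le)
    show "a (cls m) c < a k j"
    proof (cases "k = cls m")
      case True
      then have "i \<noteq> 0 \<or> c' \<noteq> c" using k i by auto
      have "c' = c"
      proof (rule ccontr)
        assume "c' \<noteq> c"
        then consider "c' < c" | "c < c'" by linarith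
        then show False
        proof cases
          case 1
          then show ?thesis using c(3)[OF 1] c'(1)[of 0] True pos[OF k(1), of 0] by simp
        next
          case 2
          then show ?thesis using c'(2)[OF 2] c(1)[of 0] True pos[OF k(1), of 0] by simp
        qed
      qed
      with \<open>i \<noteq> 0 \<or> c' \<noteq> c\<close> have "arrival (?w k) 0 < arrival (?w k) i"
        using pos[OF k(1)] by (intro arrival_strict_mono) auto
      then show ?thesis using c(1)[of 0] c'(1)[of i] i \<open>c' = c\<close> True by simp
    next
      case False
      then have "fst (shd (?w (cls m))) < fst (shd (?w k))"
        using cycle(2)[of m] k(1) unfolding leads_def by auto
      also have "\<dots> \<le> arrival (?w k) i"
        using arrival_mono[of "?w k" i] pos[OF k(1)] by simp
      finally show ?thesis using c(1)[of 0] c'(1)[of i] i by simp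
    qed
  qed
  with first show thesis by (rule that[rotated 1]) 
qed

text \<open>
  The packet admitted in cycle \<open>m\<close> is the first point of the leading class of the \<open>m\<close>-th restarted
  paths. From here on only the sequences \<open>cls\<close>, \<open>idle\<close> and \<open>service\<close> matter.
\<close>

lemma served_cycle:
  "fst (served N a s m) = cls m \<and> generation_time N a s m = epoch m + idle m \<and>
    reception_time N a s m = epoch (Suc m)"
proof -
  have *: "served N a s m = next_arrival N a (epoch m)"
  proof (induction m)
    case 0
    then show ?case by (simp add: epoch_def)
  next
    case (Suc m)
    obtain c where "next_arrival N a (epoch m) = (cls m, c)"
      "a (cls m) c = epoch m + idle m" "s (cls m) c = service m"
      by (rule next_arrival_epoch)
    with Suc show ?case by (simp add: epoch_def add_ac)
  qed
  obtain c where "next_arrival N a (epoch m) = (cls m, c)"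
    "a (cls m) c = epoch m + idle m" "s (cls m) c = service m"
    by (rule next_arrival_epoch)
  with * show ?thesis
    by (simp add: generation_time_def reception_time_def epoch_def)
qed

lemma strict_mono_reception: "strict_mono (reception_time N a s)"
proof -
  have "epoch (Suc m) < epoch (Suc (Suc m))" for m
    using cycle(4,5)[of "Suc m"] by (simp add: epoch_def)
  then show ?thesis
    using served_cycle by (simp add: strict_mono_Suc_iff)
qed

lemma class_served_eq: "class_served N a s n = {m. cls m = n}"
  using served_cycle by (simp add: class_served_def)

text \<open>
  Needed for \<open>enumerate\<close> to list the class-\<open>n\<close> admissions properly: a class with a positive long-run
  share of the cycles is served infinitely often.
\<close>

lemma infinite_class_served:
  assumes "(\<lambda>m. (\<Sum>i<m. of_bool (cls i = n)) / real m) \<longlonglongrightarrow> p" and "0 < p"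
  shows "infinite (class_served N a s n)"
proof
  assume fin: "finite (class_served N a s n)"
  have bound: "(\<Sum>i<m. of_bool (cls i = n)) \<le> real (card (class_served N a s n))" for m
  proof -
    have "(\<Sum>i<m. of_bool (cls i = n)) = real (card ({..<m} \<inter> class_served N a s n))"
      by (simp add: class_served_eq Collect_conj_eq[symmetric] sum_of_bool_eq)
    also have "\<dots> \<le> real (card (class_served N a s n))"
      using fin by (intro of_nat_mono card_mono) auto
    finally show ?thesis .
  qed
  have "(\<lambda>m. (\<Sum>i<m. of_bool (cls i = n)) / real m) \<longlonglongrightarrow> 0"
  proof (rule tendsto_sandwich[where f="\<lambda>_. 0" and h="\<lambda>m. real (card (class_served N a s n)) / real m"])
    show "(\<lambda>m. real (card (class_served N a s n)) / real m) \<longlonglongrightarrow> 0"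
      by (rule lim_const_over_n)
    show "eventually (\<lambda>m. (\<Sum>i<m. of_bool (cls i = n)) / real m \<le>
        real (card (class_served N a s n)) / real m) sequentially"
      by (intro always_eventually allI divide_right_mono bound) simp
    show "eventually (\<lambda>m. 0 \<le> (\<Sum>i<m. of_bool (cls i = n)) / real m) sequentially"
      by (intro always_eventually allI divide_nonneg_nonneg sum_nonneg) simp_all
  qed simp
  with assms show False using LIMSEQ_unique by blast
qed

text \<open>
  Apart from the first one, each peak is the difference of two successive class-\<open>n\<close> generation times
  plus a class-\<open>n\<close> service time, so the sum of the peaks telescopes. Averages over the class-\<open>n\<close>
  admissions \<open>e K\<close> are averages over all cycles divided by the share \<open>p\<close>, because \<open>K / e K\<close> tends
  to \<open>p\<close>. The initial age \<open>\<delta>\<close> enters through the first peak alone and vanishes in the limit.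
\<close>

lemma has_peak_aoi_from_averages:
  assumes share: "(\<lambda>m. (\<Sum>i<m. of_bool (cls i = n)) / real m) \<longlonglongrightarrow> p" and p: "0 < p"
    and idle: "(\<lambda>m. (\<Sum>i<m. idle i) / real m) \<longlonglongrightarrow> \<gamma>"
    and service: "(\<lambda>m. (\<Sum>i<m. service i) / real m) \<longlonglongrightarrow> \<nu>"
    and own: "(\<lambda>m. (\<Sum>i<m. of_bool (cls i = n) * service i) / real m) \<longlonglongrightarrow> \<upsilon>"
  shows "has_peak_aoi N a s \<delta> n ((\<upsilon> + \<gamma> + \<nu>) / p)"
proof -
  let ?C = "class_served N a s n"
  define e where "e = enumerate ?C"
  have inf: "infinite ?C" by (rule infinite_class_served[OF share p])
  have e_ge: "K \<le> e K" for K
    unfolding e_def using inf by (rule le_enumerate)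
  have e_lim: "filterlim e at_top sequentially"
    by (rule filterlim_at_top_mono[OF filterlim_ident]) (simp add: e_ge)
  define g where "g m = epoch m + idle m" for m
  have g_eq: "g m = (\<Sum>i<Suc m. idle i) + (\<Sum>i<m. service i)" for m
    by (simp add: g_def epoch_def sum.distrib)
  have ratio: "(\<lambda>K. real (e K) / real K) \<longlonglongrightarrow> 1 / p"
  proof -
    have "real K / real (e K) = (\<Sum>i<e K. of_bool (cls i = n)) / real (e K)" for K
      using sum_enumerate[OF inf, of "\<lambda>_. 1" K]
      by (simp add: e_def class_served_eq of_bool_def)
    then have "(\<lambda>K. real K / real (e K)) \<longlonglongrightarrow> p"
      using filterlim_compose[OF share e_lim] by (simp only:)
    from tendsto_divide[OF tendsto_const this, of 1] p show ?thesis by simp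
  qed
  have g_lim: "(\<lambda>m. g m / real m) \<longlonglongrightarrow> \<gamma> + \<nu>"
  proof -
    have "(\<lambda>m. (\<Sum>i<Suc m. idle i) / real (Suc m)) \<longlonglongrightarrow> \<gamma>"
      using idle by (rule LIMSEQ_Suc)
    moreover have "(\<lambda>m. real (Suc m) / real m) \<longlonglongrightarrow> 1"
      using LIMSEQ_Suc_n_over_n .
    ultimately have "(\<lambda>m. (\<Sum>i<Suc m. idle i) / real (Suc m) * (real (Suc m) / real m) + (\<Sum>i<m. service i) / real m) \<longlonglongrightarrow> \<gamma> * 1 + \<nu>"
      by (intro tendsto_add tendsto_mult service)
    moreover have "(\<Sum>i<Suc m. idle i) / real (Suc m) * (real (Suc m) / real m) + (\<Sum>i<m. service i) / real m = g m / real m" for m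
      unfolding g_eq add_divide_distrib by (simp del: of_nat_Suc sum.lessThan_Suc)
    ultimately show ?thesis by simp
  qed
  have over: "(\<lambda>K. f (e K) / real K) \<longlonglongrightarrow> c / p"
    if "(\<lambda>m. f m / real m) \<longlonglongrightarrow> c" for f :: "nat \<Rightarrow> real" and c
  proof -
    have "(\<lambda>K. f (e K) / real (e K) * (real (e K) / real K)) \<longlonglongrightarrow> c * (1 / p)"
      by (intro tendsto_mult ratio filterlim_compose[OF that e_lim])
    moreover have "eventually (\<lambda>K. f (e K) / real (e K) * (real (e K) / real K) = f (e K) / real K) sequentially"
      using eventually_gt_at_top[of 0]
    proof eventually_elim
      fix K :: nat assume "0 < K"
      with e_ge[of K] have "real (e K) \<noteq> 0" by simp
      then show "f (e K) / real (e K) * (real (e K) / real K) = f (e K) / real K"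
        by simp
    qed
    ultimately have "(\<lambda>K. f (e K) / real K) \<longlonglongrightarrow> c * (1 / p)"
      by (rule Lim_transform_eventually)
    then show ?thesis by simp
  qed
  \<comment> \<open>the first peak and the boundary terms of the telescoping sum\<close>
  define c where "c = peak_age N a s \<delta> n 0 - g (e 0) - service (e 0)"
  have peaks: "(\<Sum>k<Suc K. peak_age N a s \<delta> n k) =
      c + g (e K) + (\<Sum>i<e (Suc K). of_bool (cls i = n) * service i)" for K
  proof -
    have "(\<Sum>k<Suc K. peak_age N a s \<delta> n k) =
        peak_age N a s \<delta> n 0 + (\<Sum>k<K. peak_age N a s \<delta> n (Suc k))"
      by (rule sum.lessThan_Suc_shift)
    also have "(\<Sum>k<K. peak_age N a s \<delta> n (Suc k)) =
        (\<Sum>k<K. g (e (Suc k)) - g (e k)) + (\<Sum>k<K. service (e (Suc k)))"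
      using served_cycle
      by (simp add: peak_age_Suc[OF inf strict_mono_reception] e_def[symmetric] g_def epoch_def
          sum.distrib[symmetric] algebra_simps)
    also have "\<dots> = g (e K) - g (e 0) + ((\<Sum>k<Suc K. service (e k)) - service (e 0))"
      using sum_lessThan_telescope[of "\<lambda>k. g (e k)" K] sum.lessThan_Suc_shift[of "\<lambda>k. service (e k)" K]
      by simp
    also have "(\<Sum>k<Suc K. service (e k)) = (\<Sum>i<e (Suc K). of_bool (cls i = n) * service i)"
      unfolding e_def sum_enumerate[OF inf] by (intro sum.cong) (auto simp: class_served_eq)
    finally show ?thesis by (simp add: c_def)
  qed
  have "(\<lambda>K. c / real (Suc K) + g (e K) / real K * (real K / real (Suc K)) +
      (\<Sum>i<e (Suc K). of_bool (cls i = n) * service i) / real (Suc K)) \<longlonglongrightarrow> 0 + (\<gamma> + \<nu>) / p * 1 + \<upsilon> / p"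
    by (intro tendsto_add tendsto_mult over g_lim LIMSEQ_n_over_Suc_n
        LIMSEQ_Suc[OF over[OF own]] LIMSEQ_Suc[OF lim_const_over_n])
  moreover have "eventually (\<lambda>K. c / real (Suc K) + g (e K) / real K * (real K / real (Suc K)) +
      (\<Sum>i<e (Suc K). of_bool (cls i = n) * service i) / real (Suc K) =
      (\<Sum>k<Suc K. peak_age N a s \<delta> n k) / real (Suc K)) sequentially"
    using eventually_gt_at_top[of 0]
  proof eventually_elim
    fix K :: nat assume "0 < K"
    then have "g (e K) / real K * (real K / real (Suc K)) = g (e K) / real (Suc K)"
      by simp
    then show "c / real (Suc K) + g (e K) / real K * (real K / real (Suc K)) +
      (\<Sum>i<e (Suc K). of_bool (cls i = n) * service i) / real (Suc K) =
      (\<Sum>k<Suc K. peak_age N a s \<delta> n k) / real (Suc K)"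
      by (simp only: peaks add_divide_distrib)
  qed
  ultimately have "(\<lambda>K. (\<Sum>k<Suc K. peak_age N a s \<delta> n k) / real (Suc K)) \<longlonglongrightarrow> 0 + (\<gamma> + \<nu>) / p * 1 + \<upsilon> / p"
    by (rule Lim_transform_eventually)
  also have "0 + (\<gamma> + \<nu>) / p * 1 + \<upsilon> / p = (\<upsilon> + \<gamma> + \<nu>) / p"
    by (simp add: add_divide_distrib)
  finally show ?thesis
    unfolding has_peak_aoi_def by (rule LIMSEQ_imp_Suc)
qed

end

section \<open>From the arrival processes to the peak age\<close>

text \<open>
  Regrouping an independent family: first into pairs of a gap and a service time, which gives the
  law of each path, and then into whole paths, which makes the classes independent.
\<close>

lemma (in prob_space) distr_marked_paths:
  fixes G S :: "nat \<Rightarrow> nat \<Rightarrow> 'a \<Rightarrow> real"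
  assumes indep: "indep_vars (\<lambda>_. borel) (case_sum (\<lambda>(k, j). G k j) (\<lambda>(k, j). S k j)) ((I \<times> UNIV) <+> (I \<times> UNIV))"
    and gaps: "\<And>k j. k \<in> I \<Longrightarrow> distr M borel (G k j) = exponential (l k)"
    and marks: "\<And>k j. k \<in> I \<Longrightarrow> distr M borel (S k j) = \<sigma> k"
    and I: "I \<noteq> {}"
  shows "(\<lambda>\<omega>. \<lambda>k\<in>I. to_stream (\<lambda>j. (G k j \<omega>, S k j \<omega>))) \<in> M \<rightarrow>\<^sub>M (\<Pi>\<^sub>M k\<in>I. paths)" (is ?meas)
    and "distr M (\<Pi>\<^sub>M k\<in>I. paths) (\<lambda>\<omega>. \<lambda>k\<in>I. to_stream (\<lambda>j. (G k j \<omega>, S k j \<omega>))) =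
      (\<Pi>\<^sub>M k\<in>I. marked_poisson (l k) (\<sigma> k))" (is ?law)
proof -
  let ?V = "case_sum (\<lambda>(k, j). G k j) (\<lambda>(k, j). S k j)"
  define P where "P k = (\<lambda>\<omega>. to_stream (\<lambda>j. (G k j \<omega>, S k j \<omega>)))" for k
  have G_rv: "G k j \<in> borel_measurable M" and S_rv: "S k j \<in> borel_measurable M" if "k \<in> I" for k j
  proof -
    have "\<forall>i\<in>(I \<times> UNIV) <+> (I \<times> UNIV). ?V i \<in> borel_measurable M"
      using indep unfolding indep_vars_def by blast
    from bspec[OF this, of "Inl (k, j)"] bspec[OF this, of "Inr (k, j)"] that
    show "G k j \<in> borel_measurable M" "S k j \<in> borel_measurable M" by auto
  qed
  have pair_rv: "(\<lambda>\<omega>. (G k j \<omega>, S k j \<omega>)) \<in> M \<rightarrow>\<^sub>M borel \<Otimes>\<^sub>M borel" if "k \<in> I" for k j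
    using G_rv[OF that] S_rv[OF that] by measurable
  have P_rv: "P k \<in> M \<rightarrow>\<^sub>M paths" if "k \<in> I" for k
    unfolding P_def
    by (intro measurable_compose[OF measurable_PiM_single' measurable_to_stream] pair_rv[OF that])
      (auto simp: space_pair_measure)
  then show ?meas
    unfolding P_def by (intro measurable_restrict)
  have law: "distr M paths (P k) = marked_poisson (l k) (\<sigma> k)" if k: "k \<in> I" for k
  proof -
    have pair_law: "distr M (borel \<Otimes>\<^sub>M borel) (\<lambda>\<omega>. (G k j \<omega>, S k j \<omega>)) = exponential (l k) \<Otimes>\<^sub>M \<sigma> k" for j
    proof -
      have "indep_var (PiM {Inl (k, j)} (\<lambda>_. borel)) (\<lambda>\<omega>. restrict (\<lambda>i. ?V i \<omega>) {Inl (k, j)})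
          (PiM {Inr (k, j)} (\<lambda>_. borel)) (\<lambda>\<omega>. restrict (\<lambda>i. ?V i \<omega>) {Inr (k, j)})"
        using k by (intro indep_var_restrict[OF indep]) auto
      then have "indep_var borel ((\<lambda>f. f (Inl (k, j))) \<circ> (\<lambda>\<omega>. restrict (\<lambda>i. ?V i \<omega>) {Inl (k, j)}))
          borel ((\<lambda>f. f (Inr (k, j))) \<circ> (\<lambda>\<omega>. restrict (\<lambda>i. ?V i \<omega>) {Inr (k, j)}))"
        by (rule indep_var_compose) measurable
      then have "indep_var borel (G k j) borel (S k j)"
        by (simp add: comp_def)
      then have "distr M borel (G k j) \<Otimes>\<^sub>M distr M borel (S k j) =
          distr M (borel \<Otimes>\<^sub>M borel) (\<lambda>\<omega>. (G k j \<omega>, S k j \<omega>))"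
        unfolding indep_var_distribution_eq by blast
      then show ?thesis by (simp add: gaps[OF k] marks[OF k])
    qed
    have "indep_vars (\<lambda>j. PiM {Inl (k, j), Inr (k, j)} (\<lambda>_. borel))
        (\<lambda>j \<omega>. restrict (\<lambda>i. ?V i \<omega>) {Inl (k, j), Inr (k, j)}) (UNIV :: nat set)"
      using k by (intro indep_vars_restrict[OF indep]) (auto simp: disjoint_family_on_def)
    then have "indep_vars (\<lambda>_. borel \<Otimes>\<^sub>M borel)
        (\<lambda>j \<omega>. (\<lambda>f. (f (Inl (k, j)), f (Inr (k, j)))) (restrict (\<lambda>i. ?V i \<omega>) {Inl (k, j), Inr (k, j)})) (UNIV :: nat set)"
      by (rule indep_vars_compose2) measurable
    then have "indep_vars (\<lambda>_. borel \<Otimes>\<^sub>M borel) (\<lambda>j \<omega>. (G k j \<omega>, S k j \<omega>)) (UNIV :: nat set)"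
      by simp
    then have joint: "distr M (\<Pi>\<^sub>M j\<in>UNIV. borel \<Otimes>\<^sub>M borel) (\<lambda>\<omega>. \<lambda>j\<in>UNIV. (G k j \<omega>, S k j \<omega>)) =
        (\<Pi>\<^sub>M j\<in>UNIV. exponential (l k) \<Otimes>\<^sub>M \<sigma> k)"
      using pair_rv[OF k] by (subst (asm) indep_vars_iff_distr_eq_PiM) (simp_all add: pair_law)
    have sets_eq: "sets (exponential (l k) \<Otimes>\<^sub>M \<sigma> k) = sets (borel \<Otimes>\<^sub>M borel)"
      using arg_cong[OF marks[OF k, of 0], of sets] by (intro sets_pair_measure_cong) simp_all
    have "marked_poisson (l k) (\<sigma> k) = distr (\<Pi>\<^sub>M j\<in>UNIV. exponential (l k) \<Otimes>\<^sub>M \<sigma> k)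
        (stream_space (exponential (l k) \<Otimes>\<^sub>M \<sigma> k)) to_stream"
      unfolding marked_poisson_def by (rule stream_space_eq_distr)
    also have "\<dots> = distr (distr M (\<Pi>\<^sub>M j\<in>UNIV. borel \<Otimes>\<^sub>M borel) (\<lambda>\<omega>. \<lambda>j\<in>UNIV. (G k j \<omega>, S k j \<omega>))) paths to_stream"
      unfolding joint by (intro distr_cong sets_stream_space_cong sets_eq refl)
    also have "\<dots> = distr M paths (P k)"
    proof (subst distr_distr)
      show "to_stream \<in> (\<Pi>\<^sub>M j\<in>UNIV. borel \<Otimes>\<^sub>M borel) \<rightarrow>\<^sub>M paths" by measurable
      show "(\<lambda>\<omega>. \<lambda>j\<in>UNIV. (G k j \<omega>, S k j \<omega>)) \<in> M \<rightarrow>\<^sub>M (\<Pi>\<^sub>M j\<in>UNIV. borel \<Otimes>\<^sub>M borel)"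
        by (intro measurable_restrict pair_rv[OF k])
    qed (simp add: P_def comp_def restrict_UNIV)
    finally show ?thesis ..
  qed
  let ?K = "\<lambda>k. {Inl (k, j) | j. True} \<union> {Inr (k, j) | j. True} :: (nat \<times> nat + nat \<times> nat) set"
  have "indep_vars (\<lambda>k. PiM (?K k) (\<lambda>_. borel)) (\<lambda>k \<omega>. restrict (\<lambda>i. ?V i \<omega>) (?K k)) I"
    by (intro indep_vars_restrict[OF indep]) (auto simp: disjoint_family_on_def)
  then have "indep_vars (\<lambda>_. paths) (\<lambda>k \<omega>. (\<lambda>f. to_stream (\<lambda>j. (f (Inl (k, j)), f (Inr (k, j)))))
      (restrict (\<lambda>i. ?V i \<omega>) (?K k))) I"
  proof (rule indep_vars_compose2)
    fix k
    have "(\<lambda>f. (f (Inl (k, j)), f (Inr (k, j)))) \<in> PiM (?K k) (\<lambda>_. borel) \<rightarrow>\<^sub>M borel \<Otimes>\<^sub>M borel" for j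
      by (intro measurable_Pair measurable_component_singleton) auto
    then show "(\<lambda>f. to_stream (\<lambda>j. (f (Inl (k, j)), f (Inr (k, j))))) \<in> PiM (?K k) (\<lambda>_. borel) \<rightarrow>\<^sub>M paths"
      by (intro measurable_compose[OF measurable_PiM_single' measurable_to_stream])
        (auto simp: space_pair_measure)
  qed
  then have "indep_vars (\<lambda>_. paths) P I"
    by (simp add: P_def[abs_def])
  then have "distr M (\<Pi>\<^sub>M k\<in>I. paths) (\<lambda>\<omega>. \<lambda>k\<in>I. P k \<omega>) = (\<Pi>\<^sub>M k\<in>I. distr M paths (P k))"
    using I P_rv by (subst (asm) indep_vars_iff_distr_eq_PiM') simp_all
  also have "\<dots> = (\<Pi>\<^sub>M k\<in>I. marked_poisson (l k) (\<sigma> k))"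
    by (intro PiM_cong law refl)
  finally show ?law by (simp only: P_def)
qed

lemma snth_to_stream: "to_stream X !! j = X j"
  by (simp add: to_stream_def)

lemma arrival_to_stream_gap:
  "arrival (to_stream (\<lambda>j. (gap T j \<omega>, S j \<omega>))) j = T j \<omega>"
  by (induction j) (simp_all add: arrival_Suc gap_def to_stream_def)

theorem proposition3:
  fixes M :: "'a measure" and N n :: nat and lam x :: "nat \<Rightarrow> real"
    and T S :: "nat \<Rightarrow> nat \<Rightarrow> 'a \<Rightarrow> real" and \<delta> :: real
  assumes "prob_space M"
    and "\<And>k. k \<in> {1..N} \<Longrightarrow> 0 < lam k"
    and "\<And>k. k \<in> {1..N} \<Longrightarrow> poisson_process M (lam k) (T k)"
    and "\<And>k j. k \<in> {1..N} \<Longrightarrow> AE \<omega> in M. 0 \<le> S k j \<omega>"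
    and "\<And>k j. k \<in> {1..N} \<Longrightarrow> distr M borel (S k j) = distr M borel (S k 0)"
    and "\<And>k j. k \<in> {1..N} \<Longrightarrow> integrable M (S k j)"
    and "\<And>k j. k \<in> {1..N} \<Longrightarrow> prob_space.expectation M (S k j) = x k"
    and "prob_space.indep_vars M (\<lambda>_. borel)
           (case_sum (\<lambda>(k, j). gap (T k) j) (\<lambda>(k, j). S k j))
           (({1..N} \<times> UNIV) <+> ({1..N} \<times> UNIV))"
    and "0 \<le> \<delta>"
    and "n \<in> {1..N}"
  shows "AE \<omega> in M. has_peak_aoi N (\<lambda>k j. T k j \<omega>) (\<lambda>k j. S k j \<omega>) \<delta> n
           (x n + 1 / lam n + (\<Sum>k=1..N. lam k * x k) / lam n)"
proof -
  interpret M: prob_space M by fact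
  define I where "I = {1..N}"
  note assms = assms[folded I_def]
  have S_rv: "S k j \<in> borel_measurable M" if "k \<in> I" for k j
    using assms(6)[OF that] by auto
  \<comment> \<open>arbitrary proper values outside of the class set\<close>
  define l where "l k = (if k \<in> I then lam k else 1)" for k
  define \<sigma> where "\<sigma> k = (if k \<in> I then distr M borel (S k 0) else return borel 0)" for k
  define \<Phi> where "\<Phi> \<omega> = (\<lambda>k\<in>I. to_stream (\<lambda>j. (gap (T k) j \<omega>, S k j \<omega>)))" for \<omega>
  interpret served_classes I l \<sigma> x
  proof (intro served_classes.intro poisson_classes.intro served_classes_axioms.intro)
    show "finite I" "I \<noteq> {}" using assms(10) by (auto simp: I_def)
    show "poisson_marks (l k) (\<sigma> k)" for k
      using assms(2) S_rv
      by (auto simp: poisson_marks_def l_def \<sigma>_def intro!: M.prob_space_distr prob_space_return)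
    fix k assume k: "k \<in> I"
    note [measurable] = S_rv[OF k]
    have \<sigma>_k: "\<sigma> k = distr M borel (S k 0)" using k by (simp add: \<sigma>_def)
    show "AE s in \<sigma> k. 0 \<le> s"
      unfolding \<sigma>_k by (subst AE_distr_iff) (use assms(4)[OF k, of 0] in simp_all)
    show "(\<integral>\<^sup>+s. ennreal s \<partial>\<sigma> k) = ennreal (x k)"
      using nn_integral_eq_integral[OF assms(6)[OF k, of 0] assms(4)[OF k, of 0]] assms(7)[OF k, of 0]
      by (simp add: \<sigma>_k nn_integral_distr)
    show "0 \<le> x k"
      using integral_nonneg_AE[OF assms(4)[OF k, of 0]] assms(7)[OF k, of 0] by simp
  qed
  have gaps: "distr M borel (gap (T k) j) = exponential (l k)" if "k \<in> I" for k j
  proof -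
    have "distributed M lborel (gap (T k) j) (exponential_density (lam k))"
      using assms(3)[OF that] by (simp add: poisson_process_def)
    then have "distr M lborel (gap (T k) j) = exponential (lam k)"
      by (rule distributed_distr_eq_density)
    moreover have "distr M lborel (gap (T k) j) = distr M borel (gap (T k) j)"
      by (rule distr_cong) simp_all
    ultimately show ?thesis using that by (simp add: l_def)
  qed
  have marks: "distr M borel (S k j) = \<sigma> k" if "k \<in> I" for k j
    using assms(5)[OF that] that by (simp add: \<sigma>_def)
  note paths_law = M.distr_marked_paths[OF assms(8) gaps marks nonempty_classes, folded \<Phi>_def superposed_def]
  have share: "0 < l n / total_rate"
    using total_rate_pos cl.rate_pos by simp
  have n: "n \<in> I" by (fact assms(10))
  have "AE w in superposed. (\<lambda>m. (\<Sum>i<m. of_bool (fst (head ((restart ^^ i) w)) = n)) / real m)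
      \<longlonglongrightarrow> (\<Sum>k\<in>I. l k / total_rate * of_bool (k = n))"
    by (rule cycle.cycle_averages[where h="\<lambda>y. of_bool (fst y = n)", OF _ mean_class_weight[of "\<lambda>k. of_bool (k = n)"]])
      simp_all
  moreover have "AE w in superposed. (\<lambda>m. (\<Sum>i<m. fst (snd (head ((restart ^^ i) w)))) / real m)
      \<longlonglongrightarrow> 1 / total_rate"
    by (rule cycle.cycle_averages[where h="\<lambda>y. fst (snd y)", OF _ mean_gap]) simp
  moreover have "AE w in superposed. (\<lambda>m. (\<Sum>i<m. 1 * snd (snd (head ((restart ^^ i) w)))) / real m)
      \<longlonglongrightarrow> (\<Sum>k\<in>I. l k / total_rate * (1 * x k))"
    by (rule cycle.cycle_averages[where h="\<lambda>y. 1 * snd (snd y)", OF _ mean_weighted_mark[of "\<lambda>_. 1"]]) simp_all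
  moreover have "AE w in superposed. (\<lambda>m. (\<Sum>i<m. of_bool (fst (head ((restart ^^ i) w)) = n) *
      snd (snd (head ((restart ^^ i) w)))) / real m)
      \<longlonglongrightarrow> (\<Sum>k\<in>I. l k / total_rate * (of_bool (k = n) * x k))"
    by (rule cycle.cycle_averages[where h="\<lambda>y. of_bool (fst y = n) * snd (snd y)",
          OF _ mean_weighted_mark[of "\<lambda>k. of_bool (k = n)"]]) simp_all
  moreover have "AE w in superposed. \<forall>i. regular ((restart ^^ i) w)"
    unfolding AE_all_countable by (intro allI cycle.AE_iterate AE_regular)
  \<comment> \<open>stated for all sequences that agree with \<open>w\<close> on \<open>I\<close>, as the given ones are arbitrary elsewhere\<close>
  ultimately have main: "AE w in superposed. \<forall>a s. (\<forall>k\<in>I. \<forall>j. a k j = arrival (w k) j \<and> s k j = snd (w k !! j)) \<longrightarrow>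
      has_peak_aoi N a s \<delta> n (x n + 1 / lam n + (\<Sum>k\<in>I. lam k * x k) / lam n)"
  proof eventually_elim
    case (elim w)
    show ?case
    proof (intro allI impI)
      fix a s
      assume *: "\<forall>k\<in>I. \<forall>j. a k j = arrival (w k) j \<and> s k j = snd (w k !! j)"
      interpret sample_path I l \<sigma> N w a s
        by unfold_locales (use * elim(5) in \<open>auto simp: I_def\<close>)
      have 1: "(\<Sum>k\<in>I. l k / total_rate * of_bool (k = n)) = l n / total_rate"
        using n finite_classes by (simp add: of_bool_def if_distrib cong: if_cong)
      have 2: "(\<Sum>k\<in>I. l k / total_rate * (1 * x k)) = (\<Sum>k\<in>I. lam k * x k) / total_rate"
        unfolding sum_divide_distrib by (intro sum.cong) (auto simp: l_def)
      have 3: "(\<Sum>k\<in>I. l k / total_rate * (of_bool (k = n) * x k)) = l n / total_rate * x n"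
        using n finite_classes by (simp add: of_bool_def if_distrib if_distribR cong: if_cong)
      have "has_peak_aoi N a s \<delta> n ((l n / total_rate * x n + 1 / total_rate +
          (\<Sum>k\<in>I. lam k * x k) / total_rate) / (l n / total_rate))"
        using has_peak_aoi_from_averages[of n "l n / total_rate" "1 / total_rate"
            "(\<Sum>k\<in>I. lam k * x k) / total_rate" "l n / total_rate * x n" \<delta>] elim(1-4) share
        unfolding 1 2 3 cls_def idle_def service_def by simp
      also have "(l n / total_rate * x n + 1 / total_rate +
          (\<Sum>k\<in>I. lam k * x k) / total_rate) / (l n / total_rate) =
          x n + 1 / lam n + (\<Sum>k\<in>I. lam k * x k) / lam n"
        using total_rate_pos assms(2)[OF n] n by (simp add: l_def field_simps)
      finally show "has_peak_aoi N a s \<delta> n (x n + 1 / lam n + (\<Sum>k\<in>I. lam k * x k) / lam n)" .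
    qed
  qed
  define good where "good w \<longleftrightarrow> (\<forall>a s. (\<forall>k\<in>I. \<forall>j. a k j = arrival (w k) j \<and> s k j = snd (w k !! j)) \<longrightarrow>
      has_peak_aoi N a s \<delta> n (x n + 1 / lam n + (\<Sum>k\<in>I. lam k * x k) / lam n))" for w
  have "AE w in superposed. good w"
    using main by (rule eventually_mono) (simp add: good_def)
  then have "AE w in distr M world \<Phi>. good w"
    by (simp only: paths_law(2))
  then have "AE \<omega> in M. good (\<Phi> \<omega>)"
    using paths_law(1) by (intro AE_distrD[of \<Phi> M world good]) simp_all
  then have "AE \<omega> in M. has_peak_aoi N (\<lambda>k j. T k j \<omega>) (\<lambda>k j. S k j \<omega>) \<delta> n
      (x n + 1 / lam n + (\<Sum>k\<in>I. lam k * x k) / lam n)"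
  proof eventually_elim
    case (elim \<omega>)
    show ?case
      by (rule elim[unfolded good_def, rule_format])
        (simp add: \<Phi>_def arrival_to_stream_gap snth_to_stream)
  qed
  then show ?thesis by (simp only: I_def)
qed

end
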